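(* For a sequence $S=(s_i)_{i\ge1}$ of non-negative integers, let $|\lambda|_S=\sum_{i\ge1}\lambda_i s_i$. For every non-negative integer $m$ the following hold. (1) If $s_i=1$ when $i=n(n-1)/2+1$ for some $n\ge1$ and $s_i=0$ otherwise, the number of partitions of $S$-weight $m$ is equal to the number of plane partitions of weight $m$. The corresponding identity is $$\sum_{\lambda\in \mathcal{P}} q^{|\lambda|_S} = \prod_{n\geq 1} \frac{1}{(1-q^n)^n}.$$ (2) If $s_i=1$ when $i=n(n+1)/2$ for some $n\ge1$ and $s_i=0$ otherwise, the number of partitions of $S$-weight $m$ is equal to the number of pairs $(\mu,\nu)$, where $\mu$ is a partition and $\nu$ is a plane partition, whose weight sum is $m$. The corresponding identity is $$\sum_{\lambda\in \mathcal{P}} q^{|\lambda|_S} = \frac{1}{(q;q)_\infty}\cdot\prod_{n\geq 1} \frac{1}{(1-q^n)^n}.$$ (3) If $s_i=1$ when $i=n^2$ for some $n\ge1$ and $s_i=0$ otherwise, the number of partitions of $S$-weight $m$ is equal to the number of triplets $(\mu,\nu,\kappa)$, where $\mu$ is a partition and $\nu,\kappa$ are plane partitions, whose weight sum is $m$. The corresponding identity is $$\sum_{\lambda\in \mathcal{P}} q^{|\lambda|_S} = \frac{1}{(q;q)_\infty}\cdot\left(\prod_{n\geq 1} \frac{1}{(1-q^n)^n}\right)^2.$$ (4) Let $F_0=0$, $F_1=1$, $F_{n+2}=F_{n+1}+F_n$ be the Fibonacci sequence. If $s_i=1$ when $i=F_{n+1}$ for some $n\ge1$ and $s_i=0$ otherwise,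 the number of over-partitions of $S$-weight $m$ is equal to the number of over-partitions of weight $m$ where each positive integer $i$ appears in $F_i$ colors. The corresponding identity is $$\sum_{\lambda\in \overline{\mathcal{P}}} q^{|\lambda|_S} = \prod_{n\geq 1} \left(\frac{1+q^n}{1-q^n}\right)^{F_n}.$$ (5) If $s_i=1$ when $i=2^{n-1}$ for some $n\ge1$ and $s_i=0$ otherwise, the number of over-partitions of $S$-weight $m$ is equal to the number of over-partitions of weight $m$ where each positive integer $i$ appears in $2^{i-1}$ colors. The corresponding identity is $$\sum_{\lambda\in \overline{\mathcal{P}}} q^{|\lambda|_S} = \prod_{n\geq 1}\left(\frac{1+q^n}{1-q^n}\right)^{2^{n-1}}.$$
   Context: Over-lined integers: $\overline{\mathbb{Z}_{\geq 1}}=\{\overline1,\overline2,\ldots\}$ is a disjoint copy of $\mathbb{Z}_{\ge 1}$; both $i$ and $\overline i$ have size $i$, and arithmetic uses sizes. Order: $0<\overline1<1<\overline2<2<\cdots$. An over-partition is an infinite non-increasing sequence $\lambda=(\lambda_i)_{i\ge1}$ of elements of $\mathbb{Z}_{\geq 0}\sqcup\overline{\mathbb{Z}_{\geq 1}}$ with finitely many nonzero terms, in which each over-lined integer occurs at most once; $\overline{\mathcal P}$ is the set of over-partitions and $\mathcal P$ the subset of partitions (no over-lined parts). The weight is the sum of the sizes of the parts. In over-partitions where integers appear in several colors, each colored copy of an integer may occur non-over-lined any number of times and over-lined at most once (the order of parts being irrelevant for counting). A plane partition is a family $(\lambda_{i,j})_{i,j\ge1}$ of non-negative integers with finitely many positive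 terms, non-increasing in $i$ for fixed $j$ and in $j$ for fixed $i$; its weight is $\sum_{i,j}\lambda_{i,j}$. $(q;q)_\infty=\prod_{k\ge1}(1-q^k)$. Identities are between formal power series in $q$. *)

theory Defs
  imports "HOL-Analysis.Analysis" "HOL-Number_Theory.Fib" "HOL-Library.Multiset"
begin

text \<open>\<^term>\<open>Over 0\<close> does not correspond to any over-lined integer: it is a junk value, excluded
  explicitly wherever parts are used.\<close>

datatype opart = Over nat | Plain nat

fun psize :: "opart \<Rightarrow> nat" where
  "psize (Over n) = n"
| "psize (Plain n) = n"

fun overlined :: "opart \<Rightarrow> bool" where
  "overlined (Over n) = True"
| "overlined (Plain n) = False"

text \<open>The order \<open>0 < Over 1 < Plain 1 < Over 2 < Plain 2 < \<dots>\<close>.\<close>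

instantiation opart :: linorder
begin

definition less_eq_opart :: "opart \<Rightarrow> opart \<Rightarrow> bool" where
  "x \<le> y \<longleftrightarrow> psize x < psize y \<or> (psize x = psize y \<and> (overlined x \<or> \<not> overlined y))"

definition less_opart :: "opart \<Rightarrow> opart \<Rightarrow> bool" where
  "x < y \<longleftrightarrow> psize x < psize y \<or> (psize x = psize y \<and> overlined x \<and> \<not> overlined y)"

instance
proof
  fix x y z :: opart
  show "x < y \<longleftrightarrow> x \<le> y \<and> \<not> y \<le> x" "x \<le> x" "x \<le> y \<or> y \<le> x"
    "x \<le> y \<Longrightarrow> y \<le> z \<Longrightarrow> x \<le> z"
    by (auto simp: less_eq_opart_def less_opart_def)
  show "x \<le> y \<Longrightarrow> y \<le> x \<Longrightarrow> x = y"
    by (cases x; cases y) (auto simp: less_eq_opart_def)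
qed

end

text \<open>Sequences indexed by the positive integers are represented with a shift: \<open>l i\<close> is the part
  \<open>\<lambda>\<^bsub>i+1\<^esub>\<close>.\<close>

definition overpartitions :: "(nat \<Rightarrow> opart) set" where
  "overpartitions = {l. decseq l \<and> (\<forall>i. l i \<noteq> Over 0) \<and> finite {i. l i \<noteq> Plain 0} \<and>
     (\<forall>n i j. l i = Over n \<and> l j = Over n \<longrightarrow> i = j)}"

definition partitions :: "(nat \<Rightarrow> opart) set" where
  "partitions = {l \<in> overpartitions. \<forall>i. \<not> overlined (l i)}"

definition weight :: "(nat \<Rightarrow> opart) \<Rightarrow> nat" where
  "weight l = (\<Sum>i | l i \<noteq> Plain 0. psize (l i))"

text \<open>The weight \<open>|\<lambda>|\<^sub>S\<close>. Unlike the over-partition, \<open>S\<close> is indexed from 1 as on paper, and the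
  value \<open>S 0\<close> is never used.\<close>

definition S_weight :: "(nat \<Rightarrow> nat) \<Rightarrow> (nat \<Rightarrow> opart) \<Rightarrow> nat" where
  "S_weight S l = (\<Sum>i | l i \<noteq> Plain 0. psize (l i) * S (Suc i))"

text \<open>Over-partitions in which the integer \<open>i\<close> appears in \<open>C i\<close> colors: finite multisets of
  colored parts \<open>(x, k)\<close> with color \<open>k < C (psize x)\<close>.\<close>

definition colored_overpartitions :: "(nat \<Rightarrow> nat) \<Rightarrow> (opart \<times> nat) multiset set" where
  "colored_overpartitions C = {M.
     (\<forall>(x, k) \<in># M. psize x \<ge> 1 \<and> k < C (psize x)) \<and>
     (\<forall>n k. count M (Over n, k) \<le> 1)}"

definition colored_weight :: "(opart \<times> nat) multiset \<Rightarrow> nat" where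
  "colored_weight M = (\<Sum>(x, k) \<in># M. psize x)"

text \<open>Both indices are shifted by one, as above.\<close>

definition plane_partitions :: "(nat \<Rightarrow> nat \<Rightarrow> nat) set" where
  "plane_partitions = {p. finite {(i, j). p i j > 0} \<and>
     (\<forall>j. decseq (\<lambda>i. p i j)) \<and> (\<forall>i. decseq (\<lambda>j. p i j))}"

definition plane_weight :: "(nat \<Rightarrow> nat \<Rightarrow> nat) \<Rightarrow> nat" where
  "plane_weight p = (\<Sum>(i, j) | p i j > 0. p i j)"

text \<open>\<open>(q;q)\<^sub>\<infinity>\<close>, the limit being taken in the \<open>q\<close>-adic topology of formal power series.\<close>

definition qq_inf :: "rat fps" where
  "qq_inf = (\<Prod>k. 1 - fps_X ^ Suc k)"

definition equinumerous_finite :: "'a set \<Rightarrow> 'b set \<Rightarrow> bool" where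
  "equinumerous_finite A B \<longleftrightarrow> finite A \<and> finite B \<and> card A = card B"

end

theory Submission
  imports Defs
begin

text \<open>
  Reading an over-partition column by column turns its \<open>S\<close>-weight into a sum over columns, a column
  of height \<open>k\<close> contributing \<open>s\<^sub>1 + \<dots> + s\<^sub>k\<close>; the last part of a block of equal parts may be
  over-lined, which marks at most one column of each occurring height. If \<open>s\<close> is the indicator of
  the values of a strictly increasing sequence \<open>p\<close> with \<open>p 0 = 1\<close>, then exactly \<open>p (n + 1) - p n\<close>
  heights contribute \<open>n + 1\<close>, so the generating function is a product over \<open>n\<close>.
  The remaining ingredient is MacMahon's product for plane partitions. The diagonals of a boxed plane
  partition form an interlacing sequence of partitions that first grows and then shrinks; a local
  bijection exchanges a growing step with the shrinking step after it at the cost of one geometric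
  series, until only the trivial sequence is left.
\<close>

text \<open>Coefficient \<open>m\<close> of an infinite product sees only finitely many factors, so
  all products are compared modulo \<open>fps_X ^ Suc m\<close>, with congruence written as
  divisibility of a difference. Infinite counting problems are cut down in the same way: objects of
  weight \<open>m\<close> already live over a finite index set or in an \<open>m\<close> by
  \<open>m\<close> box. The condition \<open>p 0 = 1\<close> makes every column contribute at least
  \<open>1\<close>, so that only finitely many objects have a given weight. The gaps of
  \<open>p\<close> are the exponents of the product: they split as \<open>1 + (n + 1)\<close> and
  \<open>1 + (n + 1) + (n + 1)\<close> in the second and third case, where exponent \<open>1\<close>
  is the series of partitions and \<open>n + 1\<close> that of plane partitions, and they become
  numbers of colors for over-partitions. The exchange of steps has to turn a valley into a peak,
  which has one bounded part less to match: part \<open>i\<close> of the valley and part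
  \<open>i + 1\<close> of the peak obey the same bounds, and the largest part of the peak, unbounded
  above, supplies the geometric series. Words with arbitrary weights occur because exchanging steps
  of the word of a box leads outside words of that form.\<close>

unbundle no vec_syntax
unbundle fps_syntax

section \<open>Congruences and infinite products of formal power series\<close>

text \<open>The way back from congruences to coefficients; the divisibility lemmas that follow are
  closure properties of these congruences under finite products.\<close>

lemma fps_nth_eq_of_dvd:
  fixes F G :: "'a :: comm_ring_1 fps"
  assumes "fps_X ^ n dvd F - G" "m < n"
  shows "F $ m = G $ m"
proof -
  obtain H where "F - G = fps_X ^ n * H"
    using assms(1) by (elim dvdE)
  then have "(F - G) $ m = 0"
    using assms(2) by (simp add: fps_X_power_mult_nth)
  then show ?thesis by simp
qed

lemma dvd_mult_minus_one:
  fixes a b d :: "'a :: comm_ring_1"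
  assumes "d dvd a - 1" "d dvd b - 1"
  shows "d dvd a * b - 1"
proof -
  have "a * b - 1 = (a - 1) * b + (b - 1)" by (simp add: algebra_simps)
  then show ?thesis using assms by (metis dvd_add dvd_mult2)
qed

lemma dvd_mult_diff:
  fixes a b d :: "'a :: comm_ring_1"
  assumes "d dvd a - a'" "d dvd b - b'"
  shows "d dvd a * b - a' * b'"
proof -
  have "a * b - a' * b' = (a - a') * b + a' * (b - b')" by (simp add: algebra_simps)
  then show ?thesis using assms by (metis dvd_add dvd_mult dvd_mult2)
qed

lemma dvd_prod_minus_one:
  fixes f :: "'b \<Rightarrow> 'a :: comm_ring_1"
  assumes "\<And>i. i \<in> I \<Longrightarrow> d dvd f i - 1"
  shows "d dvd prod f I - 1"
  using assms by (induction I rule: infinite_finite_induct) (auto intro: dvd_mult_minus_one)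

lemma dvd_power_minus_one:
  fixes a :: "'a :: comm_ring_1"
  assumes "d dvd a - 1"
  shows "d dvd a ^ n - 1"
  using dvd_prod_minus_one[of "{..<n}" d "\<lambda>_. a"] assms by simp

lemma tendsto_mult_fps:
  fixes F G :: "'a :: comm_ring_1 fps"
  assumes "(f \<longlongrightarrow> F) A" "(g \<longlongrightarrow> G) A"
  shows "((\<lambda>x. f x * g x) \<longlongrightarrow> F * G) A"
proof (rule tendsto_fpsI)
  fix n
  have "eventually (\<lambda>x. \<forall>i\<in>{..n}. f x $ i = F $ i) A" "eventually (\<lambda>x. \<forall>i\<in>{..n}. g x $ i = G $ i) A"
    using assms unfolding tendsto_fps_iff by (auto intro!: eventually_ball_finite)
  then show "eventually (\<lambda>x. (f x * g x) $ n = (F * G) $ n) A"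
    by eventually_elim (auto simp: fps_mult_nth intro!: sum.cong)
qed

text \<open>\<open>has_prod\<close> also admits the value \<open>0\<close> produced by a zero
  factor. Nonzero values exclude that case and leave convergence of the partial products.\<close>

lemma has_prod_mult_fps:
  fixes F G :: "'a :: idom fps"
  assumes "f has_prod F" "g has_prod G" "F \<noteq> 0" "G \<noteq> 0"
  shows "(\<lambda>n. f n * g n) has_prod (F * G)"
proof -
  have "(\<lambda>n. \<Prod>k\<le>n. f k * g k) \<longlonglongrightarrow> F * G"
    unfolding prod.distrib by (intro tendsto_mult_fps has_prod_imp_tendsto assms)
  then show ?thesis
    using assms by (simp add: has_prod_def raw_has_prod_def)
qed

lemma inverse_prod_fps:
  fixes f :: "'b \<Rightarrow> 'a :: field fps"
  shows "inverse (prod f I) = (\<Prod>i\<in>I. inverse (f i))"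
  by (induction I rule: infinite_finite_induct) (auto simp: fps_inverse_mult)

lemma has_prod_inverse_fps:
  fixes F :: "'a :: field fps"
  assumes "f has_prod F" "F $ 0 \<noteq> 0"
  shows "(\<lambda>n. inverse (f n)) has_prod inverse F"
proof -
  have "(\<lambda>n. \<Prod>k\<le>n. inverse (f k)) \<longlonglongrightarrow> inverse F"
    unfolding inverse_prod_fps[symmetric]
    by (intro tendsto_inverse_fps has_prod_imp_tendsto assms)
  then show ?thesis
    using assms by (simp add: has_prod_def raw_has_prod_def)
qed

text \<open>Factors with index at least \<open>m\<close> are \<open>1\<close> modulo
  \<open>fps_X ^ Suc m\<close>, so coefficient \<open>m\<close> of the partial products is constant
  from \<open>N = m\<close> on. The limit is assembled from these stable coefficients, and the
  explicit bound \<open>m \<le> N\<close> lets later proofs pass to a finite product.\<close>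

lemma
  fixes f :: "nat \<Rightarrow> 'a :: idom fps"
  assumes f: "\<And>n. fps_X ^ Suc n dvd f n - 1"
  shows has_prod_prodinf_fps: "f has_prod prodinf f"
    and prodinf_fps_nth: "m \<le> N \<Longrightarrow> prodinf f $ m = (\<Prod>n<N. f n) $ m"
    and prodinf_fps_nth_0: "prodinf f $ 0 = 1"
proof -
  define F where "F = Abs_fps (\<lambda>m. (\<Prod>n<m. f n) $ m)"
  have stable: "(\<Prod>n<N. f n) $ m = F $ m" if "m \<le> N" for m N
  proof -
    have "fps_X ^ Suc m dvd prod f {m..<N} - 1"
    proof (rule dvd_prod_minus_one)
      fix i assume "i \<in> {m..<N}"
      then show "fps_X ^ Suc m dvd f i - 1"
        by (intro dvd_trans[OF le_imp_power_dvd f]) auto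
    qed
    then have "fps_X ^ Suc m dvd prod f {..<m} * (prod f {m..<N} - 1)"
      by (rule dvd_mult)
    moreover have "prod f {..<m} * (prod f {m..<N} - 1) = prod f {..<N} - prod f {..<m}"
      using prod.atLeastLessThan_concat[of 0 m N f] that
      by (simp add: atLeast0LessThan algebra_simps)
    ultimately show ?thesis
      unfolding F_def fps_nth_Abs_fps by (metis fps_nth_eq_of_dvd lessI)
  qed
  have "(\<lambda>n. \<Prod>k\<le>n. f k) \<longlonglongrightarrow> F"
  proof (rule tendsto_fpsI)
    fix m
    show "eventually (\<lambda>n. (\<Prod>k\<le>n. f k) $ m = F $ m) sequentially"
      using eventually_ge_at_top[of m]
      by eventually_elim (metis stable lessThan_Suc_atMost le_SucI)
  qed
  moreover have F0: "F $ 0 = 1" by (simp add: F_def)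
  ultimately have F: "f has_prod F"
    by (auto simp: has_prod_def raw_has_prod_def)
  then have eq: "prodinf f = F" using has_prod_unique by blast
  show "f has_prod prodinf f" "prodinf f $ 0 = 1" using F F0 eq by auto
  show "prodinf f $ m = (\<Prod>n<N. f n) $ m" if "m \<le> N"
    using stable[OF that] eq by simp
qed

text \<open>Factors with \<open>h i > m\<close> are \<open>1\<close> modulo
  \<open>fps_X ^ Suc m\<close>, and the others are grouped by the value of \<open>h\<close>. This is
  how cardinalities of fibres turn into the exponents of the final products.\<close>

lemma X_power_dvd_prod_diff_prod_fibres:
  fixes f :: "nat \<Rightarrow> 'a :: comm_ring_1 fps"
  assumes f: "\<And>n. fps_X ^ n dvd f n - 1"
    and I: "finite I" "\<And>i. i \<in> I \<Longrightarrow> h i \<ge> 1"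
  shows "fps_X ^ Suc m dvd (\<Prod>i\<in>I. f (h i)) - (\<Prod>n<m. f (Suc n) ^ card {i \<in> I. h i = Suc n})"
proof -
  let ?J = "{i \<in> I. h i \<le> m}" and ?K = "{i \<in> I. \<not> h i \<le> m}"
  have "(\<Prod>i\<in>I. f (h i)) = (\<Prod>i\<in>?J \<union> ?K. f (h i))" by (rule prod.cong) auto
  also have "\<dots> = (\<Prod>i\<in>?J. f (h i)) * (\<Prod>i\<in>?K. f (h i))"
    using I by (intro prod.union_disjoint) auto
  finally have split: "(\<Prod>i\<in>I. f (h i)) = (\<Prod>i\<in>?J. f (h i)) * (\<Prod>i\<in>?K. f (h i))" .
  have "(\<Prod>n<m. f (Suc n) ^ card {i \<in> I. h i = Suc n})
      = (\<Prod>n\<in>{1..m}. f n ^ card {i \<in> I. h i = n})"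
    by (rule prod.reindex_bij_witness[of _ "\<lambda>n. n - 1" Suc]) auto
  also have "\<dots> = (\<Prod>n\<in>{1..m}. \<Prod>i\<in>{i \<in> ?J. h i = n}. f (h i))"
  proof (rule prod.cong[OF refl])
    fix n assume "n \<in> {1..m}"
    then have "{i \<in> ?J. h i = n} = {i \<in> I. h i = n}" by auto
    then show "f n ^ card {i \<in> I. h i = n} = (\<Prod>i\<in>{i \<in> ?J. h i = n}. f (h i))"
      by simp
  qed
  also have "\<dots> = (\<Prod>i\<in>?J. f (h i))"
    using I by (intro prod.group) auto
  finally have J: "(\<Prod>n<m. f (Suc n) ^ card {i \<in> I. h i = Suc n}) = (\<Prod>i\<in>?J. f (h i))" .
  have "fps_X ^ Suc m dvd (\<Prod>i\<in>?K. f (h i)) - 1"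
  proof (rule dvd_prod_minus_one)
    fix i assume "i \<in> ?K"
    then show "fps_X ^ Suc m dvd f (h i) - 1"
      by (intro dvd_trans[OF le_imp_power_dvd f]) auto
  qed
  then have "fps_X ^ Suc m dvd (\<Prod>i\<in>?J. f (h i)) * ((\<Prod>i\<in>?K. f (h i)) - 1)"
    by (rule dvd_mult)
  then show ?thesis unfolding split J by (simp add: algebra_simps)
qed

section \<open>Generating functions of weighted sets\<close>

definition geom :: "nat \<Rightarrow> rat fps" where
  "geom n = inverse (1 - fps_X ^ n)"

lemma one_minus_X_power_nth_0 [simp]: "n \<ge> 1 \<Longrightarrow> (1 - fps_X ^ n :: 'a :: comm_ring_1 fps) $ 0 = 1"
  by (auto simp: fps_X_power_nth)

lemma geom_mult: "n \<ge> 1 \<Longrightarrow> (1 - fps_X ^ n) * geom n = 1"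
  by (simp add: geom_def mult.commute[of _ "inverse _"] inverse_mult_eq_1)

lemma X_power_dvd_geom_minus_one: "fps_X ^ n dvd geom n - 1"
proof (cases "n = 0")
  case False
  then have "geom n - 1 = fps_X ^ n * geom n"
    using geom_mult[of n] by (simp add: algebra_simps)
  then show ?thesis by simp
qed auto

lemma X_power_dvd_one_plus_minus_one:
  "(fps_X :: 'a :: comm_ring_1 fps) ^ n dvd (1 + fps_X ^ n) - 1"
  by simp

text \<open>Since \<open>card\<close> of an infinite set is \<open>0\<close>, the finiteness clause
  keeps an infinite fibre from passing as an empty one.\<close>

definition has_gf :: "'a set \<Rightarrow> ('a \<Rightarrow> nat) \<Rightarrow> rat fps \<Rightarrow> bool" where
  "has_gf A w F \<longleftrightarrow> (\<forall>n. finite {a \<in> A. w a = n} \<and> of_nat (card {a \<in> A. w a = n}) = F $ n)"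

lemma has_gf_bij:
  assumes "bij_betw f A B" "\<And>a. a \<in> A \<Longrightarrow> v (f a) = w a" "has_gf A w F"
  shows "has_gf B v F"
proof -
  have bij: "bij_betw f {a \<in> A. w a = n} {b \<in> B. v b = n}" for n
  proof (rule bij_betw_subset[OF assms(1)])
    have "{b \<in> f ` A. v b = n} = f ` {a \<in> A. v (f a) = n}" by blast
    also have "{a \<in> A. v (f a) = n} = {a \<in> A. w a = n}" using assms(2) by auto
    finally show "f ` {a \<in> A. w a = n} = {b \<in> B. v b = n}"
      using assms(1) by (simp add: bij_betw_def)
  qed auto
  show ?thesis
    using assms(3) bij_betw_finite[OF bij] bij_betw_same_card[OF bij] by (simp add: has_gf_def)
qed

lemma has_gf_times:
  assumes A: "has_gf A w F" and B: "has_gf B v G"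
  shows "has_gf (A \<times> B) (\<lambda>(a, b). w a + v b) (F * G)"
  unfolding has_gf_def
proof
  fix n
  let ?P = "\<lambda>i. {a \<in> A. w a = i} \<times> {b \<in> B. v b = n - i}"
  have eq: "{x \<in> A \<times> B. (case x of (a, b) \<Rightarrow> w a + v b) = n} = (\<Union>i\<in>{0..n}. ?P i)"
    by auto
  have fin: "finite (?P i)" for i
    using A B by (auto simp: has_gf_def)
  have "of_nat (card (\<Union>i\<in>{0..n}. ?P i)) = (\<Sum>i=0..n. of_nat (card (?P i)) :: rat)"
    by (subst card_UN_disjoint) (use fin in auto)
  also have "\<dots> = (F * G) $ n"
    using A B by (auto simp: has_gf_def fps_mult_nth card_cartesian_product intro!: sum.cong)
  finally show "finite {x \<in> A \<times> B. (case x of (a, b) \<Rightarrow> w a + v b) = n} \<and>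
     of_nat (card {x \<in> A \<times> B. (case x of (a, b) \<Rightarrow> w a + v b) = n}) = (F * G) $ n"
    unfolding eq using fin by auto
qed

text \<open>The approximating set and series may vary with \<open>n\<close>: each only has to be
  right at weight \<open>n\<close>, which allows a different finite index set or box for every
  coefficient.\<close>

lemma has_gf_limit:
  assumes "\<And>n. has_gf (B n) w (G n)"
    and "\<And>n. {a \<in> A. w a = n} = {a \<in> B n. w a = n}"
    and "\<And>n. F $ n = G n $ n"
  shows "has_gf A w F"
  using assms unfolding has_gf_def by simp

lemma has_gf_equinumerous:
  assumes "has_gf A w F" "has_gf B v F"
  shows "equinumerous_finite {a \<in> A. w a = m} {b \<in> B. v b = m}"
  using assms unfolding has_gf_def equinumerous_finite_def by (metis of_nat_eq_iff)

text \<open>Convergence of power series means that each coefficient is eventually constant.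
  Coefficient \<open>n\<close> of a finite partial sum is final once the sum contains the finite set
  of elements of weight \<open>n\<close>.\<close>

lemma has_gf_has_sum:
  assumes "has_gf A w F"
  shows "((\<lambda>a. fps_X ^ w a) has_sum F) A"
  unfolding has_sum_def
proof (rule tendsto_fpsI)
  fix n
  let ?X = "{a \<in> A. w a = n}"
  have fin: "finite ?X" and card: "of_nat (card ?X) = F $ n"
    using assms by (auto simp: has_gf_def)
  have "(\<Sum>a\<in>Y. fps_X ^ w a) $ n = F $ n" if Y: "finite Y" "?X \<subseteq> Y" "Y \<subseteq> A" for Y
  proof -
    have "(\<Sum>a\<in>Y. fps_X ^ w a) $ n = (\<Sum>a\<in>Y. if w a = n then 1 else 0 :: rat)"
      by (auto simp: fps_sum_nth fps_X_power_nth intro!: sum.cong)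
    also have "\<dots> = (\<Sum>a\<in>?X. 1)"
      using Y by (intro sum.mono_neutral_cong_right) auto
    finally show ?thesis using card by simp
  qed
  then show "eventually (\<lambda>Y. (\<Sum>a\<in>Y. fps_X ^ w a) $ n = F $ n) (finite_subsets_at_top A)"
    unfolding eventually_finite_subsets_at_top using fin by (intro exI[of _ ?X]) auto
qed

section \<open>Series of multisets with restricted multiplicities\<close>

lemma has_gf_singleton: "w a = 0 \<Longrightarrow> has_gf {a} w 1"
  unfolding has_gf_def
proof
  fix n assume "w a = 0"
  then have "{x \<in> {a}. w x = n} = (if n = 0 then {a} else {})" by auto
  then show "finite {x \<in> {a}. w x = n} \<and> of_nat (card {x \<in> {a}. w x = n}) = (1 :: rat fps) $ n"
    by simp
qed

lemma has_gf_le_one: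
  assumes "h \<ge> 1"
  shows "has_gf {..1} (\<lambda>a. h * a) (1 + fps_X ^ h)"
  unfolding has_gf_def
proof
  fix n
  have "{a \<in> {..1}. h * a = n} = (if n = 0 then {0} else if n = h then {1} else {})"
    using assms by (auto simp: le_Suc_eq)
  then show "finite {a \<in> {..1}. h * a = n} \<and>
      of_nat (card {a \<in> {..1}. h * a = n}) = (1 + fps_X ^ h :: rat fps) $ n"
    using assms by (auto simp: fps_X_power_nth)
qed

lemma has_gf_nat:
  assumes h: "h \<ge> 1"
  shows "has_gf (UNIV :: nat set) (\<lambda>a. h * a) (geom h)"
proof -
  define F :: "rat fps" where "F = Abs_fps (\<lambda>n. if h dvd n then 1 else 0)"
  have "(1 - fps_X ^ h) * F = 1"
  proof (rule fps_ext)
    fix n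
    show "((1 - fps_X ^ h) * F) $ n = 1 $ n"
    proof (cases "n < h")
      case True
      then have "h dvd n \<longleftrightarrow> n = 0" using nat_dvd_not_less by auto
      then show ?thesis
        using True by (auto simp: left_diff_distrib fps_X_power_mult_nth F_def)
    next
      case False
      then have "h dvd n \<longleftrightarrow> h dvd n - h" by (auto simp: dvd_minus_self)
      then show ?thesis
        using False h by (auto simp: left_diff_distrib fps_X_power_mult_nth F_def)
    qed
  qed
  then have geom: "geom h = F"
    using h by (metis geom_mult mult_cancel_left mult_zero_left zero_neq_one)
  have "{a \<in> UNIV. h * a = n} = (if h dvd n then {n div h} else {})" for n
    using h by auto
  then show ?thesis unfolding has_gf_def geom F_def by simp
qed

text \<open>A common model for the columns of an over-partition and for colored over-partitions; in
  both uses \<open>B\<close> consists of the over-lined elements.\<close>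

definition bounded_msets :: "'a set \<Rightarrow> 'a set \<Rightarrow> 'a multiset set" where
  "bounded_msets I B = {M. set_mset M \<subseteq> I \<and> (\<forall>x\<in>B. count M x \<le> 1)}"

lemma bounded_msets_insert_bij:
  fixes i :: 'a and I B :: "'a set"
  assumes i: "i \<notin> I"
  defines "D \<equiv> (if i \<in> B then {..1 :: nat} else UNIV) \<times> bounded_msets I B"
  shows "bij_betw (\<lambda>(a, M). replicate_mset a i + M) D (bounded_msets (insert i I) B)"
proof (rule bij_betw_byWitness[where f' = "\<lambda>M. (count M i, filter_mset (\<lambda>x. x \<noteq> i) M)"])
  have i_notin: "count M i = 0" if "M \<in> bounded_msets I B" for M
    using i that by (auto simp: bounded_msets_def count_eq_zero_iff)
  show "\<forall>x\<in>D. (\<lambda>M. (count M i, filter_mset (\<lambda>x. x \<noteq> i) M)) ((\<lambda>(a, M). replicate_mset a i + M) x) = x"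
    by (auto simp: D_def i_notin multiset_eq_iff)
  show "\<forall>M\<in>bounded_msets (insert i I) B.
      (\<lambda>(a, M). replicate_mset a i + M) ((\<lambda>M. (count M i, filter_mset (\<lambda>x. x \<noteq> i) M)) M) = M"
    by (auto simp: multiset_eq_iff)
  show "(\<lambda>(a, M). replicate_mset a i + M) ` D \<subseteq> bounded_msets (insert i I) B"
  proof
    fix N assume "N \<in> (\<lambda>(a, M). replicate_mset a i + M) ` D"
    then obtain a M where N: "N = replicate_mset a i + M" and a: "i \<in> B \<Longrightarrow> a \<le> 1"
      and M: "M \<in> bounded_msets I B"
      by (auto simp: D_def split: if_splits)
    show "N \<in> bounded_msets (insert i I) B"
      using a M i_notin[OF M] by (auto simp: bounded_msets_def N split: if_splits)
  qed
  show "(\<lambda>M. (count M i, filter_mset (\<lambda>x. x \<noteq> i) M)) ` bounded_msets (insert i I) B \<subseteq> D"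
    by (auto simp: bounded_msets_def D_def)
qed

lemma has_gf_bounded_msets_finite:
  assumes "finite I" "\<And>i. i \<in> I \<Longrightarrow> h i \<ge> 1"
  shows "has_gf (bounded_msets I B) (\<lambda>M. \<Sum>x\<in>#M. h x)
    (\<Prod>i\<in>I. if i \<in> B then 1 + fps_X ^ h i else geom (h i))"
  using assms
proof (induction I)
  case empty
  have "bounded_msets {} B = {{#}}" by (auto simp: bounded_msets_def)
  then show ?case by (simp add: has_gf_singleton)
next
  case (insert i I)
  have "has_gf (if i \<in> B then {..1} else UNIV) (\<lambda>a. h i * a)
      (if i \<in> B then 1 + fps_X ^ h i else geom (h i))"
    using insert.prems[of i] has_gf_le_one[of "h i"] has_gf_nat[of "h i"] by auto
  then have "has_gf ((if i \<in> B then {..1} else UNIV) \<times> bounded_msets I B)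
      (\<lambda>(a, M). h i * a + (\<Sum>x\<in>#M. h x)) (\<Prod>i\<in>insert i I. if i \<in> B then 1 + fps_X ^ h i else geom (h i))"
    unfolding prod.insert[OF insert.hyps] by (rule has_gf_times) (use insert in auto)
  then show ?case
    by (rule has_gf_bij[OF bounded_msets_insert_bij[OF insert.hyps(2)], rotated]) auto
qed

text \<open>An element of a multiset of weight \<open>m\<close> has \<open>h\<close> at most
  \<open>m\<close>, so at weight \<open>m\<close> the infinite index set may be replaced by the
  finite set \<open>J m\<close>. The fibres of \<open>h\<close> below \<open>m\<close> are the same
  in \<open>I\<close> and in \<open>J m\<close>, which makes the exponents independent of
  \<open>m\<close>.\<close>

lemma has_gf_bounded_msets:
  fixes h :: "'a \<Rightarrow> nat" and I B :: "'a set"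
  assumes h: "\<And>i. i \<in> I \<Longrightarrow> h i \<ge> 1" and fin: "\<And>n. finite {i \<in> I. h i = n}"
  defines "f \<equiv> \<lambda>n. (1 + fps_X ^ Suc n) ^ card {i \<in> I \<inter> B. h i = Suc n} *
    geom (Suc n) ^ card {i \<in> I - B. h i = Suc n}"
  shows "f has_prod prodinf f"
    and "has_gf (bounded_msets I B) (\<lambda>M. \<Sum>x\<in>#M. h x) (prodinf f)"
proof -
  have f: "fps_X ^ Suc n dvd f n - 1" for n
    unfolding f_def
    by (intro dvd_mult_minus_one dvd_power_minus_one X_power_dvd_geom_minus_one
        X_power_dvd_one_plus_minus_one)
  then show "f has_prod prodinf f" by (rule has_prod_prodinf_fps)
  define J where "J m = {i \<in> I. h i \<le> m}" for m
  have J: "finite (J m)" for m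
  proof -
    have "J m = (\<Union>n\<le>m. {i \<in> I. h i = n})" by (auto simp: J_def)
    then show ?thesis using fin by simp
  qed
  define G where "G m = (\<Prod>i\<in>J m. if i \<in> B then 1 + fps_X ^ h i else geom (h i))" for m
  show "has_gf (bounded_msets I B) (\<lambda>M. \<Sum>x\<in>#M. h x) (prodinf f)"
  proof (rule has_gf_limit)
    show "has_gf (bounded_msets (J m) B) (\<lambda>M. \<Sum>x\<in>#M. h x) (G m)" for m
      unfolding G_def using h J by (intro has_gf_bounded_msets_finite) (auto simp: J_def)
    have "h x \<le> (\<Sum>x\<in>#M. h x)" if "x \<in># M" for x M
      using that by (induction M) auto
    then show "{M \<in> bounded_msets I B. (\<Sum>x\<in>#M. h x) = m} =
        {M \<in> bounded_msets (J m) B. (\<Sum>x\<in>#M. h x) = m}" for m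
      by (auto simp: bounded_msets_def J_def)
    fix m
    have fibre: "{i \<in> J m \<inter> B. h i = Suc n} = {i \<in> I \<inter> B. h i = Suc n}"
        "{i \<in> J m - B. h i = Suc n} = {i \<in> I - B. h i = Suc n}" if "n < m" for n
      using that by (auto simp: J_def)
    have G: "G m = (\<Prod>i\<in>J m \<inter> B. 1 + fps_X ^ h i) * (\<Prod>i\<in>J m - B. geom (h i))"
      unfolding G_def using J by (subst prod.If_cases) (auto simp: Diff_eq)
    have f_prod: "(\<Prod>n<m. f n) =
        (\<Prod>n<m. (1 + fps_X ^ Suc n) ^ card {i \<in> J m \<inter> B. h i = Suc n}) *
        (\<Prod>n<m. geom (Suc n) ^ card {i \<in> J m - B. h i = Suc n})"
      unfolding f_def prod.distrib[symmetric]
      by (rule prod.cong[OF refl]) (simp only: fibre lessThan_iff)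
    have "fps_X ^ Suc m dvd G m - (\<Prod>n<m. f n)"
      unfolding G f_prod using J h
      by (intro dvd_mult_diff X_power_dvd_prod_diff_prod_fibres X_power_dvd_one_plus_minus_one
          X_power_dvd_geom_minus_one) (auto simp: J_def)
    from fps_nth_eq_of_dvd[OF this lessI] show "prodinf f $ m = G m $ m"
      using prodinf_fps_nth[OF f, of m m] by simp
  qed
qed

section \<open>Interlacing sequences\<close>

text \<open>The chain \<open>l 0 \<ge> m 0 \<ge> l 1 \<ge> m 1 \<ge> ...\<close>, that is, the skew
  shape between \<open>m\<close> and \<open>l\<close> is a horizontal strip. It forces both
  sequences to be non-increasing.\<close>

definition interlaces :: "(nat \<Rightarrow> nat) \<Rightarrow> (nat \<Rightarrow> nat) \<Rightarrow> bool" where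
  "interlaces l m \<longleftrightarrow> (\<forall>i. m i \<le> l i \<and> l (Suc i) \<le> m i)"

text \<open>A step \<open>(True, z)\<close> of a word goes up, a step \<open>(False, z)\<close> goes down; \<open>z\<close> is the weight of one
  unit of change in size. Attaching the weights to steps, not to positions, is what keeps them
  non-negative when two steps are exchanged.\<close>

definition paths :: "(bool \<times> nat) list \<Rightarrow> (nat \<Rightarrow> nat \<Rightarrow> nat) set" where
  "paths w = {L. L 0 = (\<lambda>_. 0) \<and> (\<forall>k\<ge>length w. L k = (\<lambda>_. 0)) \<and>
     (\<forall>k<length w. if fst (w ! k) then interlaces (L (Suc k)) (L k) else interlaces (L k) (L (Suc k)))}"

definition step_weight :: "nat \<Rightarrow> bool \<times> nat \<Rightarrow> (nat \<Rightarrow> nat) \<Rightarrow> (nat \<Rightarrow> nat) \<Rightarrow> nat" where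
  "step_weight M s l m = snd s * (if fst s then sum m {..<M} - sum l {..<M} else sum l {..<M} - sum m {..<M})"

text \<open>The cut-off loses nothing, because shape \<open>k\<close> vanishes from index
  \<open>k\<close> on and all shapes vanish after the last step. It exceeds \<open>length w\<close>
  by one so that the neighbours of a peak are zero at the last summed index, as
  \<open>sum_local_up\<close> requires.\<close>

definition path_weight :: "(bool \<times> nat) list \<Rightarrow> (nat \<Rightarrow> nat \<Rightarrow> nat) \<Rightarrow> nat" where
  "path_weight w L = (\<Sum>k<length w. step_weight (Suc (length w)) (w ! k) (L k) (L (Suc k)))"

text \<open>Valley \<open>k\<close> below \<open>m\<close> and \<open>n\<close>, together with a number \<open>a\<close>, corresponds to a peak above both:
  part \<open>i\<close> of the valley is reflected inside the interval
  from \<open>max (m (i + 1)) (n (i + 1))\<close> to \<open>min (m i) (n i)\<close> and becomes part \<open>i + 1\<close> of the peak,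
  whose largest part is \<open>max (m 0) (n 0) + a\<close>.\<close>

definition local_up :: "(nat \<Rightarrow> nat) \<Rightarrow> (nat \<Rightarrow> nat) \<Rightarrow> (nat \<Rightarrow> nat) \<Rightarrow> nat \<Rightarrow> nat \<Rightarrow> nat" where
  "local_up m n k a i = (case i of 0 \<Rightarrow> max (m 0) (n 0) + a
     | Suc i' \<Rightarrow> max (m i) (n i) + min (m i') (n i') - k i')"

definition local_down :: "(nat \<Rightarrow> nat) \<Rightarrow> (nat \<Rightarrow> nat) \<Rightarrow> (nat \<Rightarrow> nat) \<Rightarrow> nat \<Rightarrow> nat" where
  "local_down m n l i = max (m (Suc i)) (n (Suc i)) + min (m i) (n i) - l (Suc i)"

section \<open>The exchange of a valley and a peak\<close>

lemma interlacesD: "interlaces l m \<Longrightarrow> m i \<le> l i" "interlaces l m \<Longrightarrow> l (Suc i) \<le> m i"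
  by (simp_all add: interlaces_def)

lemma interlacesI_max_min:
  assumes "\<And>i. max (m i) (n i) \<le> l i" "\<And>i. l (Suc i) \<le> min (m i) (n i)"
  shows "interlaces l m" "interlaces l n"
  unfolding interlaces_def using assms by (meson max.boundedE min.boundedE)+

text \<open>Interlacing with both neighbours is an interval condition at each index, with the same
  interval for part \<open>i\<close> of the valley and part \<open>i + 1\<close> of the peak, and
  reflection maps that interval to itself. Part \<open>0\<close> of the peak is bounded only from
  below, hence the free number \<open>a\<close>.\<close>

lemma interlaces_local_up:
  assumes k: "interlaces m k" "interlaces n k"
  shows "interlaces (local_up m n k a) m" "interlaces (local_up m n k a) n"
proof -
  have lower: "max (m (Suc i)) (n (Suc i)) \<le> k i" and upper: "k i \<le> min (m i) (n i)" for i
    using k[THEN interlacesD(1), of i] k[THEN interlacesD(2), of i] by simp_all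
  have "max (m i) (n i) \<le> local_up m n k a i" for i
  proof (cases i)
    case (Suc i')
    show ?thesis using upper[of i'] unfolding local_up_def Suc nat.case by linarith
  qed (simp add: local_up_def)
  moreover have "local_up m n k a (Suc i) \<le> min (m i) (n i)" for i
    using lower[of i] upper[of i] unfolding local_up_def nat.case by linarith
  ultimately show "interlaces (local_up m n k a) m" "interlaces (local_up m n k a) n"
    by (rule interlacesI_max_min)+
qed

lemma interlaces_local_down:
  assumes l: "interlaces l m" "interlaces l n"
  shows "interlaces m (local_down m n l)" "interlaces n (local_down m n l)"
proof -
  have lower: "max (m (Suc i)) (n (Suc i)) \<le> l (Suc i)" and upper: "l (Suc i) \<le> min (m i) (n i)" for i
    using l[THEN interlacesD(1), of "Suc i"] l[THEN interlacesD(2), of i] by simp_all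
  have "max (m (Suc i)) (n (Suc i)) \<le> local_down m n l i" "local_down m n l i \<le> min (m i) (n i)" for i
    using lower[of i] upper[of i] unfolding local_down_def by linarith+
  then show "interlaces m (local_down m n l)" "interlaces n (local_down m n l)"
    unfolding interlaces_def by (meson max.boundedE min.boundedE)+
qed

lemma local_down_local_up:
  assumes "interlaces m k" "interlaces n k"
  shows "local_down m n (local_up m n k a) = k"
proof
  fix i
  have "k i \<le> m i" "k i \<le> n i"
    using assms by (simp_all add: interlacesD)
  then show "local_down m n (local_up m n k a) i = k i"
    by (simp add: local_up_def local_down_def)
qed

lemma local_up_local_down:
  assumes "interlaces l m" "interlaces l n"
  shows "local_up m n (local_down m n l) (l 0 - max (m 0) (n 0)) = l"
proof
  fix i
  have *: "m i \<le> l i" "l (Suc i) \<le> m i" "n i \<le> l i" "l (Suc i) \<le> n i" for i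
    using assms by (simp_all add: interlacesD)
  show "local_up m n (local_down m n l) (l 0 - max (m 0) (n 0)) i = l i"
  proof (cases i)
    case 0
    then show ?thesis using *[of 0] by (simp add: local_up_def)
  next
    case (Suc i')
    then show ?thesis using *[of i'] by (simp add: local_up_def local_down_def)
  qed
qed

text \<open>The reflection combines the maximum at \<open>i + 1\<close> with the minimum at
  \<open>i\<close>. Part \<open>0\<close> of the peak supplies the missing maximum at
  \<open>0\<close>, and the maximum at \<open>M\<close> vanishes, so after the shift maximum and
  minimum at equal indices add up to \<open>m i + n i\<close>.\<close>

lemma sum_local_up:
  assumes "interlaces m k" "interlaces n k" and zero: "m M = 0" "n M = 0"
  shows "sum (local_up m n k a) {..<Suc M} + sum k {..<Suc M} = sum m {..<Suc M} + sum n {..<Suc M} + a"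
proof -
  have *: "k i \<le> m i" "k i \<le> n i" for i
    using assms by (simp_all add: interlacesD)
  have "local_up m n k a (Suc i) + k i = max (m (Suc i)) (n (Suc i)) + min (m i) (n i)" for i
    using *[of i] by (simp add: local_up_def)
  then have "(\<Sum>i<M. local_up m n k a (Suc i)) + sum k {..<M} =
      (\<Sum>i<M. max (m (Suc i)) (n (Suc i))) + (\<Sum>i<M. min (m i) (n i))"
    unfolding sum.distrib[symmetric] by simp
  moreover have "local_up m n k a 0 = a + max (m 0) (n 0)"
    by (simp add: local_up_def)
  ultimately have "sum (local_up m n k a) {..<Suc M} + sum k {..<M} =
      a + max (m 0) (n 0) + (\<Sum>i<M. max (m (Suc i)) (n (Suc i))) + (\<Sum>i<M. min (m i) (n i))"
    unfolding sum.lessThan_Suc_shift by linarith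
  also have "\<dots> = a + (\<Sum>i<Suc M. max (m i) (n i)) + (\<Sum>i<M. min (m i) (n i))"
    by (simp only: sum.lessThan_Suc_shift add.assoc)
  also have "\<dots> = a + (\<Sum>i<M. max (m i) (n i) + min (m i) (n i))"
    using zero by (simp add: sum.distrib)
  also have "(\<Sum>i<M. max (m i) (n i) + min (m i) (n i)) = (\<Sum>i<M. m i + n i)"
    by (rule sum.cong) auto
  finally show ?thesis
    using zero *[of M] by (simp add: sum.distrib)
qed

text \<open>By interlacing, a growing step creates at most one new nonzero part and a shrinking step
  creates none.\<close>

lemma paths_eq_0:
  assumes L: "L \<in> paths w" and "k \<le> i"
  shows "L k i = 0"
  using \<open>k \<le> i\<close>
proof (induction k arbitrary: i)
  case 0
  then show ?case using L by (simp add: paths_def)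
next
  case (Suc k)
  then obtain j where j: "i = Suc j" "k \<le> j" by (cases i) auto
  show ?case
  proof (cases "k < length w")
    case True
    then have "if fst (w ! k) then interlaces (L (Suc k)) (L k) else interlaces (L k) (L (Suc k))"
      using L by (simp add: paths_def)
    then have "L (Suc k) i \<le> L k j \<or> L (Suc k) i \<le> L k i"
      unfolding j by (metis interlacesD)
    then show ?thesis using Suc.IH[of j] Suc.IH[of i] j by auto
  qed (use L in \<open>simp add: paths_def\<close>)
qed

text \<open>The count of \<open>paths_eq_0\<close> run backwards from the zero shape at the end.
  Together the two bounds confine the array with these diagonals to the box.\<close>

lemma paths_eq_0':
  assumes L: "L \<in> paths w" and "k \<le> length w" "length w \<le> i + k"
  shows "L k i = 0"
  using assms(2,3)
proof (induction k arbitrary: i rule: inc_induct)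
  case base
  then show ?case using L by (simp add: paths_def)
next
  case (step k)
  then obtain j where j: "i = Suc j" by (cases i) auto
  have "if fst (w ! k) then interlaces (L (Suc k)) (L k) else interlaces (L k) (L (Suc k))"
    using L step.hyps by (simp add: paths_def)
  then have "L k i \<le> L (Suc k) i \<or> L k i \<le> L (Suc k) j"
    unfolding j by (metis interlacesD)
  then show ?case using step.IH[of j] step.IH[of i] step.prems j by auto
qed

lemma sum_mono_interlaces: "interlaces l m \<Longrightarrow> sum m {..<M} \<le> sum l {..<M}"
  by (intro sum_mono interlacesD)

text \<open>Let the neighbours be \<open>m\<close> and \<open>n\<close>, the valley \<open>k\<close>
  and the peak \<open>l\<close>. Then \<open>sum_local_up\<close> reads |l| - |m| = |n| - |k| + a
  and |l| - |n| = |m| - |k| + a. So the steps of weight \<open>x\<close> and of weight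
  \<open>y\<close> both change size by exactly \<open>a\<close> more than before, and summing over
  the free \<open>a\<close> yields \<open>geom (x + y)\<close>.\<close>

lemma has_gf_paths_swap:
  assumes xy: "x + y \<ge> 1"
    and gf: "has_gf (paths (u @ (False, y) # (True, x) # v)) (path_weight (u @ (False, y) # (True, x) # v)) F"
  shows "has_gf (paths (u @ (True, x) # (False, y) # v)) (path_weight (u @ (True, x) # (False, y) # v))
    (F * geom (x + y))"
proof -
  define w where "w = u @ (True, x) # (False, y) # v"
  define w' where "w' = u @ (False, y) # (True, x) # v"
  define j where "j = length u"
  define n where "n = length w"
  have len: "length w = n" "length w' = n" "Suc j < n"
    by (auto simp: w_def w'_def j_def n_def)
  have nth: "w ! j = (True, x)" "w ! Suc j = (False, y)" "w' ! j = (False, y)" "w' ! Suc j = (True, x)"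
    by (auto simp: w_def w'_def j_def nth_append)
  have nth': "w ! k = w' ! k" if "k \<noteq> j" "k \<noteq> Suc j" for k
    using that by (auto simp: w_def w'_def j_def nth_append nth_Cons')
  define up where "up L a = L(Suc j := local_up (L j) (L (Suc (Suc j))) (L (Suc j)) a)"
    for L :: "nat \<Rightarrow> nat \<Rightarrow> nat" and a
  define down where "down L = (L(Suc j := local_down (L j) (L (Suc (Suc j))) (L (Suc j))),
      L (Suc j) 0 - max (L j 0) (L (Suc (Suc j)) 0))" for L :: "nat \<Rightarrow> nat \<Rightarrow> nat"
  have split: "{..<n} = {j, Suc j} \<union> ({..<n} - {j, Suc j})"
    using len by auto
  \<comment> \<open>The shape \<open>L (Suc j)\<close> occurs only in the conditions at
    \<open>j\<close> and \<open>Suc j\<close>. The remaining conditions are common to both words and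
    survive replacing that shape.\<close>
  have all_split: "(\<forall>k<n. P k) \<longleftrightarrow> P j \<and> P (Suc j) \<and> (\<forall>k<n. k \<noteq> j \<and> k \<noteq> Suc j \<longrightarrow> P k)" for P
    using len by auto
  have in_w: "L \<in> paths w \<longleftrightarrow> L 0 = (\<lambda>_. 0) \<and> (\<forall>k\<ge>n. L k = (\<lambda>_. 0)) \<and>
      interlaces (L (Suc j)) (L j) \<and> interlaces (L (Suc j)) (L (Suc (Suc j))) \<and>
      (\<forall>k<n. k \<noteq> j \<and> k \<noteq> Suc j \<longrightarrow>
        (if fst (w' ! k) then interlaces (L (Suc k)) (L k) else interlaces (L k) (L (Suc k))))" for L
    unfolding paths_def len mem_Collect_eq by (subst all_split) (simp add: nth nth')
  have in_w': "L \<in> paths w' \<longleftrightarrow> L 0 = (\<lambda>_. 0) \<and> (\<forall>k\<ge>n. L k = (\<lambda>_. 0)) \<and>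
      interlaces (L j) (L (Suc j)) \<and> interlaces (L (Suc (Suc j))) (L (Suc j)) \<and>
      (\<forall>k<n. k \<noteq> j \<and> k \<noteq> Suc j \<longrightarrow>
        (if fst (w' ! k) then interlaces (L (Suc k)) (L k) else interlaces (L k) (L (Suc k))))" for L
    unfolding paths_def len mem_Collect_eq by (subst all_split) (simp add: nth)
  have bij: "bij_betw (\<lambda>(L, a). up L a) (paths w' \<times> UNIV) (paths w)"
  proof (rule bij_betw_byWitness[where f' = down])
    show "\<forall>La\<in>paths w' \<times> UNIV. down ((\<lambda>(L, a). up L a) La) = La"
      unfolding up_def down_def in_w' by (auto simp: local_down_local_up in_w') (simp add: local_up_def)
    show "\<forall>L\<in>paths w. (\<lambda>(L, a). up L a) (down L) = L"
      unfolding up_def down_def in_w by (auto simp: local_up_local_down in_w)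
    show "(\<lambda>(L, a). up L a) ` (paths w' \<times> UNIV) \<subseteq> paths w"
      using len unfolding up_def by (auto simp: in_w in_w' interlaces_local_up)
    show "down ` paths w \<subseteq> paths w' \<times> UNIV"
      using len unfolding down_def by (auto simp: in_w in_w' interlaces_local_down)
  qed
  have weight: "path_weight w (up L a) = path_weight w' L + (x + y) * a" if L: "L \<in> paths w'" for L a
  proof -
    let ?m = "L j" and ?n = "L (Suc (Suc j))" and ?k = "L (Suc j)"
    define s where "s l = sum l {..<Suc n}" for l :: "nat \<Rightarrow> nat"
    have inter: "interlaces ?m ?k" "interlaces ?n ?k" using L by (auto simp: in_w')
    have "s (local_up ?m ?n ?k a) + s ?k = s ?m + s ?n + a"
      unfolding s_def using inter paths_eq_0[OF L] len by (intro sum_local_up) auto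
    moreover have "s ?k \<le> s ?m" "s ?k \<le> s ?n"
      unfolding s_def using inter by (blast intro: sum_mono_interlaces)+
    ultimately have "s (local_up ?m ?n ?k a) - s ?m = s ?n - s ?k + a"
        "s (local_up ?m ?n ?k a) - s ?n = s ?m - s ?k + a"
      by auto
    then have local: "step_weight (Suc n) (w ! j) (up L a j) (up L a (Suc j)) +
        step_weight (Suc n) (w ! Suc j) (up L a (Suc j)) (up L a (Suc (Suc j))) =
        step_weight (Suc n) (w' ! j) (L j) (L (Suc j)) +
        step_weight (Suc n) (w' ! Suc j) (L (Suc j)) (L (Suc (Suc j))) + (x + y) * a"
      by (simp only: step_weight_def nth s_def[symmetric] up_def fun_upd_same) (simp add: algebra_simps)
    have rest: "(\<Sum>k\<in>{..<n} - {j, Suc j}. step_weight (Suc n) (w ! k) (up L a k) (up L a (Suc k))) =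
        (\<Sum>k\<in>{..<n} - {j, Suc j}. step_weight (Suc n) (w' ! k) (L k) (L (Suc k)))"
      by (rule sum.cong) (auto simp: up_def nth')
    have sum_split: "sum f {..<n} = f j + f (Suc j) + sum f ({..<n} - {j, Suc j})" for f :: "nat \<Rightarrow> nat"
      by (subst split, subst sum.union_disjoint) auto
    show ?thesis
      unfolding path_weight_def len sum_split rest using local by simp
  qed
  show ?thesis
    using has_gf_times[OF gf has_gf_nat[OF xy]] weight
    unfolding w_def[symmetric] w'_def[symmetric]
    by (intro has_gf_bij[OF bij, where w = "\<lambda>(L, a). path_weight w' L + (x + y) * a"]) auto
qed

text \<open>The growing step passes the later shrinking steps while \<open>(False, y)\<close> waits
  in the prefix, and then passes \<open>(False, y)\<close> itself; this is why the induction leaves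
  \<open>u\<close> arbitrary.\<close>

lemma has_gf_paths_move:
  assumes "x \<ge> 1"
    and "has_gf (paths (u @ map (Pair False) ys @ (True, x) # v))
      (path_weight (u @ map (Pair False) ys @ (True, x) # v)) F"
  shows "has_gf (paths (u @ (True, x) # map (Pair False) ys @ v))
    (path_weight (u @ (True, x) # map (Pair False) ys @ v)) (F * (\<Prod>y\<leftarrow>ys. geom (x + y)))"
  using assms(2)
proof (induction ys arbitrary: u)
  case (Cons y ys)
  have "has_gf (paths (u @ (False, y) # (True, x) # map (Pair False) ys @ v))
      (path_weight (u @ (False, y) # (True, x) # map (Pair False) ys @ v)) (F * (\<Prod>y\<leftarrow>ys. geom (x + y)))"
    using Cons.IH[of "u @ [(False, y)]"] Cons.prems by simp
  from has_gf_paths_swap[OF _ this] assms(1) show ?case by (simp add: mult_ac)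
qed auto

text \<open>Each growing step passes each shrinking step exactly once, which explains the double
  product. A step that has arrived is absorbed into the prefix \<open>u\<close>.\<close>

lemma has_gf_paths_move_all:
  assumes "\<And>x. x \<in> set xs \<Longrightarrow> x \<ge> 1"
    and "has_gf (paths (u @ map (Pair False) ys @ map (Pair True) xs))
      (path_weight (u @ map (Pair False) ys @ map (Pair True) xs)) F"
  shows "has_gf (paths (u @ map (Pair True) xs @ map (Pair False) ys))
    (path_weight (u @ map (Pair True) xs @ map (Pair False) ys))
    (F * (\<Prod>x\<leftarrow>xs. \<Prod>y\<leftarrow>ys. geom (x + y)))"
  using assms
proof (induction xs arbitrary: u F)
  case (Cons x xs)
  have "has_gf (paths (u @ (True, x) # map (Pair False) ys @ map (Pair True) xs))
    (path_weight (u @ (True, x) # map (Pair False) ys @ map (Pair True) xs)) (F * (\<Prod>y\<leftarrow>ys. geom (x + y)))"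
    using Cons.prems by (intro has_gf_paths_move) auto
  then have "has_gf (paths ((u @ [(True, x)]) @ map (Pair True) xs @ map (Pair False) ys))
    (path_weight ((u @ [(True, x)]) @ map (Pair True) xs @ map (Pair False) ys))
    ((F * (\<Prod>y\<leftarrow>ys. geom (x + y))) * (\<Prod>x\<leftarrow>xs. \<Prod>y\<leftarrow>ys. geom (x + y)))"
    using Cons.prems(1) by (intro Cons.IH) auto
  then show ?case by (simp add: mult.assoc)
qed auto

text \<open>Starting from zero and only shrinking keeps a shape zero; for the growing half the same
  argument runs backwards from the zero shape at the end.\<close>

lemma paths_down_up:
  "paths (map (Pair False) ys @ map (Pair True) xs) = {\<lambda>_ _. 0}"
proof -
  let ?w = "map (Pair False) ys @ map (Pair True) xs"
  have "L k i = 0" if L: "L \<in> paths ?w" for L k i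
  proof -
    have step: "if k < length ys then interlaces (L k) (L (Suc k)) else interlaces (L (Suc k)) (L k)"
      if "k < length ys + length xs" for k
      using L that by (auto simp: paths_def nth_append dest!: spec[of _ k] split: if_splits)
    have down: "k \<le> length ys \<Longrightarrow> L k i = 0" for k
    proof (induction k)
      case (Suc k)
      then show ?case using step[of k] by simp (metis interlacesD(1) le_zero_eq)
    qed (use L in \<open>simp add: paths_def\<close>)
    have up: "k \<le> length ys + length xs \<Longrightarrow> length ys \<le> k \<Longrightarrow> L k i = 0" for k
    proof (induction k rule: inc_induct)
      case (step k)
      then show ?case
        using \<open>\<And>k. k < length ys + length xs \<Longrightarrow> _\<close>[of k] by simp (metis interlacesD(1) le_zero_eq)
    qed (use L in \<open>simp add: paths_def\<close>)
    show ?thesis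
      using down[of k] up[of k] L by (cases "k \<le> length ys + length xs"; cases "k \<le> length ys") (auto simp: paths_def)
  qed
  moreover have "(\<lambda>_ _. 0) \<in> paths ?w" by (auto simp: paths_def interlaces_def)
  ultimately show ?thesis by blast
qed

lemma has_gf_paths_up_down:
  assumes "\<And>x. x \<in> set xs \<Longrightarrow> x \<ge> 1"
  shows "has_gf (paths (map (Pair True) xs @ map (Pair False) ys))
    (path_weight (map (Pair True) xs @ map (Pair False) ys)) (\<Prod>x\<leftarrow>xs. \<Prod>y\<leftarrow>ys. geom (x + y))"
proof -
  have "has_gf (paths ([] @ map (Pair False) ys @ map (Pair True) xs))
    (path_weight ([] @ map (Pair False) ys @ map (Pair True) xs)) 1"
    unfolding append_Nil paths_down_up
    by (rule has_gf_singleton) (simp add: path_weight_def step_weight_def)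
  from has_gf_paths_move_all[OF assms this] show ?thesis by simp
qed

section \<open>Plane partitions\<close>

text \<open>The weights come from summation by parts. Growth at step \<open>k\<close> is present in
  the \<open>N - k\<close> diagonals \<open>k + 1, ..., N\<close>; what disappears at step
  \<open>N + k\<close> was present in the \<open>k\<close> diagonals
  \<open>N + 1, ..., N + k\<close>. The main diagonal is charged to the growing side, so growing
  weights run over \<open>1, ..., N\<close> and shrinking ones over
  \<open>0, ..., N - 1\<close>.\<close>

definition box_word :: "nat \<Rightarrow> (bool \<times> nat) list" where
  "box_word N = map (Pair True) (map (\<lambda>k. N - k) [0..<N]) @ map (Pair False) [0..<N]"

text \<open>Diagonal \<open>k\<close> of a plane partition in an \<open>N \<times> N\<close> box starts in column \<open>0\<close> for \<open>k \<le> N\<close> and in row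
  \<open>0\<close> for \<open>k \<ge> N\<close>; truncated subtraction covers both cases.\<close>

definition diagonals :: "nat \<Rightarrow> (nat \<Rightarrow> nat \<Rightarrow> nat) \<Rightarrow> nat \<Rightarrow> nat \<Rightarrow> nat" where
  "diagonals N p k i = p (i + (N - k)) (i + (k - N))"

text \<open>For \<open>a > N + b\<close> the diagonal index truncates to \<open>0\<close>, where a
  path is zero, as it should be outside the box.\<close>

definition of_diagonals :: "nat \<Rightarrow> (nat \<Rightarrow> nat \<Rightarrow> nat) \<Rightarrow> nat \<Rightarrow> nat \<Rightarrow> nat" where
  "of_diagonals N L a b = L (N + b - a) (min a b)"

definition boxed_plane_partitions :: "nat \<Rightarrow> (nat \<Rightarrow> nat \<Rightarrow> nat) set" where
  "boxed_plane_partitions N = {p \<in> plane_partitions. \<forall>i j. N \<le> i \<or> N \<le> j \<longrightarrow> p i j = 0}"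

lemma length_box_word [simp]: "length (box_word N) = 2 * N"
  by (simp add: box_word_def)

lemma box_word_nth:
  "k < N \<Longrightarrow> box_word N ! k = (True, N - k)"
  "k < N \<Longrightarrow> box_word N ! (N + k) = (False, k)"
  by (simp_all add: box_word_def nth_append)

lemma paths_box_word_iff:
  "L \<in> paths (box_word N) \<longleftrightarrow> L 0 = (\<lambda>_. 0) \<and> (\<forall>k\<ge>2 * N. L k = (\<lambda>_. 0)) \<and>
     (\<forall>k<N. interlaces (L (Suc k)) (L k)) \<and> (\<forall>k<N. interlaces (L (N + k)) (L (Suc (N + k))))"
proof -
  have "P k" if "\<forall>k<N. P k" "\<forall>k<N. P (N + k)" "k < 2 * N" for P and k :: nat
    using that by (cases "k < N") (auto dest!: spec[of _ "k - N"])
  then have "(\<forall>k<2 * N. P k) \<longleftrightarrow> (\<forall>k<N. P k) \<and> (\<forall>k<N. P (N + k))" for P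
    by (smt (verit) add_less_mono1 add_lessD1 mult_2 nat_add_left_cancel_less)
  then show ?thesis
    unfolding paths_def by (simp add: box_word_nth)
qed

text \<open>The two inequalities of interlacing between adjacent diagonals are monotonicity in the
  two coordinate directions. Crossing the main diagonal exchanges their roles and turns growth into
  shrinking.\<close>

lemma diagonals_in_paths:
  assumes p: "p \<in> boxed_plane_partitions N"
  shows "diagonals N p \<in> paths (box_word N)"
proof -
  have zero: "N \<le> i \<or> N \<le> j \<Longrightarrow> p i j = 0" for i j
    using p by (auto simp: boxed_plane_partitions_def)
  have dec: "p (Suc i) j \<le> p i j" "p i (Suc j) \<le> p i j" for i j
    using p by (auto simp: boxed_plane_partitions_def plane_partitions_def decseq_Suc_iff)
  have "interlaces (diagonals N p (Suc k)) (diagonals N p k)" if "k < N" for k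
  proof -
    have "N - k = Suc (N - Suc k)" "k - N = 0" "Suc k - N = 0" using that by auto
    then show ?thesis using dec by (simp add: interlaces_def diagonals_def)
  qed
  moreover have "interlaces (diagonals N p (N + k)) (diagonals N p (Suc (N + k)))" for k
  proof -
    have "N - (N + k) = 0" "N - Suc (N + k) = 0" "N + k - N = k" "Suc (N + k) - N = Suc k" by auto
    then show ?thesis using dec by (simp add: interlaces_def diagonals_def)
  qed
  moreover have "diagonals N p 0 = (\<lambda>_. 0)" "2 * N \<le> k \<Longrightarrow> diagonals N p k = (\<lambda>_. 0)" for k
    unfolding diagonals_def by (rule ext, rule zero, linarith)+
  ultimately show ?thesis
    unfolding paths_box_word_iff by blast
qed

lemma of_diagonals_boxed:
  assumes L: "L \<in> paths (box_word N)"
  shows "of_diagonals N L \<in> boxed_plane_partitions N"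
proof -
  let ?p = "of_diagonals N L"
  have L0: "L 0 i = 0" "2 * N \<le> k \<Longrightarrow> L k i = 0" for i k
    using L by (auto simp: paths_box_word_iff)
  have up: "k < N \<Longrightarrow> interlaces (L (Suc k)) (L k)" for k
    using L by (simp add: paths_box_word_iff)
  have down: "N \<le> k \<Longrightarrow> interlaces (L k) (L (Suc k))" for k
  proof (cases "k < 2 * N")
    case True
    assume "N \<le> k"
    then obtain j where "k = N + j" using le_Suc_ex by blast
    then show ?thesis using L True by (simp add: paths_box_word_iff)
  qed (use L in \<open>simp add: paths_box_word_iff interlaces_def\<close>)
  have zero: "?p i j = 0" if "N \<le> i \<or> N \<le> j" for i j
  \<comment> \<open>For \<open>j \<le> i\<close> the position \<open>min i j\<close> is at least the
    diagonal index and \<open>paths_eq_0\<close> applies. For \<open>i \<le> j\<close> position and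
    index add up to \<open>N + j\<close>, which is at least \<open>2 * N\<close>, so the entry is
    zero by the count from the end or because its diagonal lies past the end.\<close>
  proof (cases "N + j - i \<le> min i j \<or> 2 * N \<le> N + j - i")
    case True
    then show ?thesis
      unfolding of_diagonals_def using paths_eq_0[OF L] L0(2) by blast
  next
    case False
    then have "2 * N \<le> min i j + (N + j - i)" using that by linarith
    then show ?thesis
      unfolding of_diagonals_def using False by (intro paths_eq_0'[OF L]) auto
  qed
  have "?p (Suc a) b \<le> ?p a b" for a b
  proof (cases "N + b \<le> a")
    case True
    then show ?thesis by (simp add: of_diagonals_def L0)
  next
    case False
    then have k: "N + b - a = Suc (N + b - Suc a)" by simp
    show ?thesis
    proof (cases "a < b")
      case True
      then have "N \<le> N + b - Suc a" "min (Suc a) b = Suc a" "min a b = a" by auto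
      then show ?thesis using interlacesD(2)[OF down] by (simp only: of_diagonals_def k)
    next
      case ab: False
      then have "N + b - Suc a < N" "min (Suc a) b = b" "min a b = b" using False by auto
      then show ?thesis using interlacesD(1)[OF up] by (simp only: of_diagonals_def k)
    qed
  qed
  moreover have "?p a (Suc b) \<le> ?p a b" for a b
  proof (cases "N + b < a")
    case True
    then show ?thesis by (simp add: of_diagonals_def L0)
  next
    case False
    then have k: "N + Suc b - a = Suc (N + b - a)" by simp
    show ?thesis
    proof (cases "a \<le> b")
      case True
      then have "N \<le> N + b - a" "min a (Suc b) = a" "min a b = a" by auto
      then show ?thesis using interlacesD(1)[OF down] by (simp only: of_diagonals_def k)
    next
      case ab: False
      then have "N + b - a < N" "min a (Suc b) = Suc b" "min a b = b" using False by auto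
      then show ?thesis using interlacesD(2)[OF up] by (simp only: of_diagonals_def k)
    qed
  qed
  moreover have "finite {(i, j). 0 < ?p i j}"
  proof (rule finite_subset)
    show "{(i, j). 0 < ?p i j} \<subseteq> {..<N} \<times> {..<N}"
    proof clarify
      fix i j assume "0 < ?p i j"
      then show "i \<in> {..<N} \<and> j \<in> {..<N}"
        using zero[of i j] by (cases "N \<le> i \<or> N \<le> j") auto
    qed
  qed simp
  ultimately show ?thesis
    using zero by (simp add: boxed_plane_partitions_def plane_partitions_def decseq_Suc_iff)
qed

lemma diagonals_bij:
  "bij_betw (diagonals N) (boxed_plane_partitions N) (paths (box_word N))"
proof (rule bij_betw_byWitness[where f' = "of_diagonals N"])
  show "\<forall>p\<in>boxed_plane_partitions N. of_diagonals N (diagonals N p) = p"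
  proof (intro ballI ext)
    fix p a b assume p: "p \<in> boxed_plane_partitions N"
    show "of_diagonals N (diagonals N p) a b = p a b"
    proof (cases "a \<le> N + b")
      case True
      then have "min a b + (N - (N + b - a)) = a" "min a b + (N + b - a - N) = b" by auto
      then show ?thesis by (simp only: of_diagonals_def diagonals_def)
    next
      case False
      then show ?thesis
        using p by (simp add: of_diagonals_def diagonals_def boxed_plane_partitions_def)
    qed
  qed
  show "\<forall>L\<in>paths (box_word N). diagonals N (of_diagonals N L) = L"
  proof (intro ballI ext)
    fix L k i
    have "N + (i + (k - N)) - (i + (N - k)) = k" "min (i + (N - k)) (i + (k - N)) = i" by auto
    then show "diagonals N (of_diagonals N L) k i = L k i"
      by (simp add: of_diagonals_def diagonals_def)
  qed
qed (use diagonals_in_paths of_diagonals_boxed in auto)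

text \<open>Summation by parts: an increase at step \<open>k\<close> is counted by the
  \<open>n - k\<close> terms after it. Monotonicity makes the truncated differences exact.\<close>

lemma sum_mult_increments:
  fixes s :: "nat \<Rightarrow> nat"
  assumes "\<And>k. k < n \<Longrightarrow> s k \<le> s (Suc k)"
  shows "(\<Sum>k<n. (n - k) * (s (Suc k) - s k)) + n * s 0 = (\<Sum>k<n. s (Suc k))"
  using assms
proof (induction n)
  case (Suc n)
  have mono: "(\<Sum>k<m. s (Suc k) - s k) + s 0 = s m" if "m \<le> Suc n" for m
    using that
  proof (induction m)
    case (Suc m)
    then show ?case using Suc.prems \<open>\<And>k. k < Suc n \<Longrightarrow> s k \<le> s (Suc k)\<close>[of m] by simp
  qed simp
  have "(\<Sum>k<Suc n. (Suc n - k) * (s (Suc k) - s k)) =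
      (\<Sum>k<Suc n. (n - k) * (s (Suc k) - s k) + (s (Suc k) - s k))"
    by (rule sum.cong) (auto simp: Suc_diff_le)
  also have "\<dots> = (\<Sum>k<n. (n - k) * (s (Suc k) - s k)) + (\<Sum>k<Suc n. s (Suc k) - s k)"
    by (simp add: sum.distrib)
  finally show ?case using Suc.IH Suc.prems mono[of "Suc n"] by simp
qed simp

text \<open>The mirror image: the amount lost at step \<open>k\<close> is counted by the terms with
  indices \<open>1, ..., k\<close>.\<close>

lemma sum_mult_decrements:
  fixes s :: "nat \<Rightarrow> nat"
  assumes "\<And>k. k < n \<Longrightarrow> s (Suc k) \<le> s k"
  shows "(\<Sum>k<n. k * (s k - s (Suc k))) + n * s n = (\<Sum>k<n. s (Suc k))"
  using assms
proof (induction n)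
  case (Suc n)
  have "n * (s n - s (Suc n)) + n * s (Suc n) = n * s n"
    using Suc.prems[of n] by (simp add: distrib_left[symmetric])
  then show ?case using Suc.IH Suc.prems by simp
qed simp

lemma path_weight_box_word:
  assumes L: "L \<in> paths (box_word N)"
  shows "path_weight (box_word N) L = (\<Sum>k<2 * N. \<Sum>i<Suc (2 * N). L k i)"
proof -
  define s where "s k = sum (L k) {..<Suc (2 * N)}" for k
  have split: "(\<Sum>k<2 * N. f k) = (\<Sum>k<N. f k) + (\<Sum>k<N. f (N + k))" for f :: "nat \<Rightarrow> nat"
    by (simp add: mult_2 sum.nat_group[symmetric] lessThan_atLeast0 sum.atLeastLessThan_concat[of 0 N "N + N", symmetric]
        sum.shift_bounds_nat_ivl[of f 0 N N, simplified] add.commute)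
  have s0: "s 0 = 0" "s (2 * N) = 0" using L by (auto simp: s_def paths_box_word_iff)
  have "path_weight (box_word N) L =
      (\<Sum>k<N. (N - k) * (s (Suc k) - s k)) + (\<Sum>k<N. k * (s (N + k) - s (N + Suc k)))"
    unfolding path_weight_def length_box_word split
    by (simp add: step_weight_def box_word_nth s_def[symmetric] del: sum.lessThan_Suc)
  also have "(\<Sum>k<N. (N - k) * (s (Suc k) - s k)) = (\<Sum>k<N. s (Suc k))"
    using sum_mult_increments[of N s] L s0
    by (simp add: paths_box_word_iff s_def sum_mono_interlaces del: sum.lessThan_Suc)
  also have "(\<Sum>k<N. k * (s (N + k) - s (N + Suc k))) = (\<Sum>k<N. s (Suc (N + k)))"
    using sum_mult_decrements[of N "\<lambda>k. s (N + k)"] L s0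
    by (simp add: paths_box_word_iff s_def sum_mono_interlaces mult_2 del: sum.lessThan_Suc)
  also have "(\<Sum>k<N. s (Suc k)) + (\<Sum>k<N. s (Suc (N + k))) = (\<Sum>k<2 * N. s (Suc k))"
    by (simp add: split)
  also have "\<dots> = (\<Sum>k<2 * N. s k)"
    using s0 sum.lessThan_Suc_shift[of s "2 * N"] by simp
  finally show ?thesis by (simp add: s_def)
qed

lemma path_weight_diagonals:
  assumes p: "p \<in> boxed_plane_partitions N"
  shows "path_weight (box_word N) (diagonals N p) = plane_weight p"
proof -
  let ?T = "{..<2 * N} \<times> {..<Suc (2 * N)}"
  have zero: "N \<le> i \<or> N \<le> j \<Longrightarrow> p i j = 0" for i j
    using p by (auto simp: boxed_plane_partitions_def)
  have fin: "finite {(i, j). 0 < p i j}"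
    using p by (simp add: boxed_plane_partitions_def plane_partitions_def)
  have "(\<Sum>(k, i)\<in>?T. diagonals N p k i) = (\<Sum>(a, b)\<in>{(a, b). 0 < p a b}. p a b)"
  \<comment> \<open>The rectangle \<open>?T\<close> contains index pairs whose cell lies outside the
    support of \<open>p\<close>. They carry value \<open>0\<close> and are discarded through
    \<open>S'\<close>; the others correspond bijectively to the cells of the support.\<close>
  proof (rule sum.reindex_bij_witness_not_neutral[where
        S' = "{x \<in> ?T. (case x of (k, i) \<Rightarrow> diagonals N p k i) = 0}" and T' = "{}" and
        i = "\<lambda>(a, b). (N + b - a, min a b)" and j = "\<lambda>(k, i). (i + (N - k), i + (k - N))"])
    fix x assume "x \<in> {(a, b). 0 < p a b} - {}"
    then obtain a b where x: "x = (a, b)" "0 < p a b" by auto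
    then have ab: "a < N" "b < N" using zero by (metis not_le not_less0)+
    then have eq: "min a b + (N - (N + b - a)) = a" "min a b + (N + b - a - N) = b" by auto
    then have val: "diagonals N p (N + b - a) (min a b) = p a b"
      by (simp only: diagonals_def)
    show "(case case x of (a, b) \<Rightarrow> (N + b - a, min a b) of
        (k, i) \<Rightarrow> (i + (N - k), i + (k - N))) = x"
      by (simp add: x eq)
    show "(case x of (a, b) \<Rightarrow> (N + b - a, min a b)) \<in>
        ?T - {x \<in> ?T. (case x of (k, i) \<Rightarrow> diagonals N p k i) = 0}"
      using ab x val by auto
  qed (use fin in \<open>auto simp: diagonals_def\<close>)
  then show ?thesis
    unfolding path_weight_box_word[OF diagonals_in_paths[OF p]] plane_weight_def
    by (simp only: sum.cartesian_product)
qed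

text \<open>MacMahon's product for at most \<open>N\<close> rows and columns with unbounded entries:
  with rows numbered backwards, the exponents are \<open>i + j - 1\<close> for \<open>i\<close>,
  \<open>j\<close> from \<open>1\<close> to \<open>N\<close>.\<close>

lemma has_gf_boxed_plane_partitions:
  "has_gf (boxed_plane_partitions N) plane_weight
    (\<Prod>(i, j)\<in>{..<N} \<times> {..<N}. geom (N - i + j))"
proof -
  have "(\<Prod>x\<leftarrow>map (\<lambda>k. N - k) [0..<N]. \<Prod>y\<leftarrow>[0..<N]. geom (x + y)) =
      (\<Prod>(i, j)\<in>{..<N} \<times> {..<N}. geom (N - i + j))"
    by (simp add: prod.list_conv_set_nth prod.cartesian_product[symmetric] lessThan_atLeast0 o_def)
  moreover have "has_gf (paths (box_word N)) (path_weight (box_word N))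
      (\<Prod>x\<leftarrow>map (\<lambda>k. N - k) [0..<N]. \<Prod>y\<leftarrow>[0..<N]. geom (x + y))"
    unfolding box_word_def by (rule has_gf_paths_up_down) auto
  moreover have "bij_betw (the_inv_into (boxed_plane_partitions N) (diagonals N))
      (paths (box_word N)) (boxed_plane_partitions N)"
    using diagonals_bij by (rule bij_betw_the_inv_into)
  moreover have "plane_weight (the_inv_into (boxed_plane_partitions N) (diagonals N) L) =
      path_weight (box_word N) L" if "L \<in> paths (box_word N)" for L
    using that diagonals_bij path_weight_diagonals
    by (metis bij_betw_def f_the_inv_into_f the_inv_into_into subset_refl)
  ultimately show ?thesis by (metis has_gf_bij)
qed

text \<open>If the entry at \<open>(i, j)\<close> is positive, so are all entries above it and to
  its left. These are at least \<open>i + 1\<close> cells in one direction and \<open>j + 1\<close>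
  in the other, so the weight exceeds both \<open>i\<close> and \<open>j\<close>.\<close>

lemma boxed_fibre:
  "{p \<in> plane_partitions. plane_weight p = m} = {p \<in> boxed_plane_partitions m. plane_weight p = m}"
proof -
  have "p i j = 0" if p: "p \<in> plane_partitions" and ij: "plane_weight p \<le> i \<or> plane_weight p \<le> j" for p i j
  proof (rule ccontr)
    assume "p i j \<noteq> 0"
    have fin: "finite {(i, j). 0 < p i j}" using p by (simp add: plane_partitions_def)
    have le: "p i j \<le> p a b" if "a \<le> i" "b \<le> j" for a b
    proof -
      have "p i j \<le> p a j" "p a j \<le> p a b"
        using p that by (auto simp: plane_partitions_def intro: decseqD)
      then show ?thesis by simp
    qed
    have card: "card X \<le> plane_weight p" if X: "X \<subseteq> {..i} \<times> {..j}" for X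
    proof -
      have sub: "X \<subseteq> {(i, j). 0 < p i j}"
      proof
        fix x assume "x \<in> X"
        then obtain a b where "x = (a, b)" "a \<le> i" "b \<le> j" using X by auto
        then show "x \<in> {(i, j). 0 < p i j}"
          using le[of a b] \<open>p i j \<noteq> 0\<close> by simp
      qed
      have "card X = (\<Sum>x\<in>X. 1)" by simp
      also have "\<dots> \<le> (\<Sum>(a, b)\<in>X. p a b)"
        using sub by (intro sum_mono) auto
      also have "\<dots> \<le> plane_weight p"
        unfolding plane_weight_def using sub fin by (intro sum_mono2) auto
      finally show ?thesis .
    qed
    have "card ({..i} \<times> {j}) \<le> plane_weight p" "card ({i} \<times> {..j}) \<le> plane_weight p"
      by (rule card; auto)+
    then show False using ij by simp
  qed
  then show ?thesis by (auto simp: boxed_plane_partitions_def)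
qed

lemma macmahon:
  defines "f \<equiv> \<lambda>n. geom (Suc n) ^ Suc n"
  shows "f has_prod prodinf f" and "has_gf plane_partitions plane_weight (prodinf f)"
proof -
  have f: "fps_X ^ Suc n dvd f n - 1" for n
    unfolding f_def by (intro dvd_power_minus_one X_power_dvd_geom_minus_one)
  then show "f has_prod prodinf f" by (rule has_prod_prodinf_fps)
  show "has_gf plane_partitions plane_weight (prodinf f)"
  proof (rule has_gf_limit[OF has_gf_boxed_plane_partitions boxed_fibre])
    fix m
    define h where "h x = m - fst x + snd x" for x :: "nat \<times> nat"
    \<comment> \<open>For \<open>n < m\<close> the box imposes no restriction: each
      \<open>j \<le> n\<close> leaves \<open>m - i = n + 1 - j\<close>, a value between
      \<open>1\<close> and \<open>m\<close>. So the multiplicity of exponent \<open>n + 1\<close>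
      already has its final value in the \<open>m\<close> by \<open>m\<close> box.\<close>
    have fibre: "card {x \<in> {..<m} \<times> {..<m}. h x = Suc n} = Suc n" if "n < m" for n
    proof -
      have "{x \<in> {..<m} \<times> {..<m}. h x = Suc n} = (\<lambda>j. (m + j - Suc n, j)) ` {..n}"
      proof
        show "{x \<in> {..<m} \<times> {..<m}. h x = Suc n} \<subseteq> (\<lambda>j. (m + j - Suc n, j)) ` {..n}"
        proof
          fix x assume "x \<in> {x \<in> {..<m} \<times> {..<m}. h x = Suc n}"
          then have "x = (m + snd x - Suc n, snd x)" "snd x \<le> n"
            by (auto simp: h_def prod_eq_iff)
          then show "x \<in> (\<lambda>j. (m + j - Suc n, j)) ` {..n}" by blast
        qed
      qed (use that in \<open>auto simp: h_def\<close>)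
      also have "card \<dots> = Suc n"
        by (subst card_image) (auto intro: inj_onI)
      finally show ?thesis .
    qed
    have "(\<Prod>n<m. geom (Suc n) ^ card {x \<in> {..<m} \<times> {..<m}. h x = Suc n}) = (\<Prod>n<m. f n)"
      by (rule prod.cong) (simp_all add: fibre f_def)
    moreover have "fps_X ^ Suc m dvd (\<Prod>x\<in>{..<m} \<times> {..<m}. geom (h x)) -
        (\<Prod>n<m. geom (Suc n) ^ card {x \<in> {..<m} \<times> {..<m}. h x = Suc n})"
      by (intro X_power_dvd_prod_diff_prod_fibres X_power_dvd_geom_minus_one) (auto simp: h_def)
    ultimately have "(\<Prod>x\<in>{..<m} \<times> {..<m}. geom (h x)) $ m = (\<Prod>n<m. f n) $ m"
      by (metis fps_nth_eq_of_dvd lessI)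
    then show "prodinf f $ m = (\<Prod>(i, j)\<in>{..<m} \<times> {..<m}. geom (m - i + j)) $ m"
      by (simp add: prodinf_fps_nth[OF f order_refl] h_def case_prod_beta)
  qed
qed

section \<open>Over-partitions by columns\<close>

text \<open>The size of the row at index \<open>i\<close>: the number of columns long enough to meet
  it.\<close>

definition tail_size :: "opart multiset \<Rightarrow> nat \<Rightarrow> nat" where
  "tail_size M i = size (filter_mset (\<lambda>x. i < psize x) M)"

text \<open>A column of height \<open>k\<close> is represented by \<open>Over k\<close> if row \<open>k\<close> (at index \<open>k - 1\<close>) is over-lined
  and the column is the marked one of its height, and by \<open>Plain k\<close> otherwise.\<close>

definition of_columns :: "opart multiset \<Rightarrow> nat \<Rightarrow> opart" where
  "of_columns M i = (if Over (Suc i) \<in># M then Over (tail_size M i) else Plain (tail_size M i))"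

text \<open>The columns of height \<open>k\<close> are as many as the size difference of the rows at
  indices \<open>k - 1\<close> and \<open>k\<close>; if the former is over-lined, one of them
  becomes \<open>Over k\<close>. For over-partitions \<open>overpartition_step\<close> makes the
  subtraction exact. Height \<open>0\<close> gets count \<open>0\<close>, so no empty columns
  occur.\<close>

definition column_count :: "(nat \<Rightarrow> opart) \<Rightarrow> opart \<Rightarrow> nat" where
  "column_count l x = (if psize x = 0 then 0
     else if overlined x then of_bool (overlined (l (psize x - 1)))
     else psize (l (psize x - 1)) - psize (l (psize x)) - of_bool (overlined (l (psize x - 1))))"

definition columns :: "(nat \<Rightarrow> opart) \<Rightarrow> opart multiset" where
  "columns l = Abs_multiset (column_count l)"

abbreviation column_msets :: "opart multiset set" where
  "column_msets \<equiv> bounded_msets {x. 1 \<le> psize x} {x. overlined x}"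

lemma tail_size_Suc:
  "tail_size M i = tail_size M (Suc i) + count M (Over (Suc i)) + count M (Plain (Suc i))"
proof (induction M)
  case (add x M)
  then show ?case by (cases x) (auto simp: tail_size_def)
qed (simp add: tail_size_def)

lemma tail_size_antimono: "i \<le> j \<Longrightarrow> tail_size M j \<le> tail_size M i"
  by (rule lift_Suc_antimono_le[of "tail_size M"]) (metis tail_size_Suc add.assoc le_add1)

lemma tail_size_less: "Over (Suc i) \<in># M \<Longrightarrow> tail_size M (Suc i) < tail_size M i"
  using tail_size_Suc[of M i] count_greater_zero_iff[of M "Over (Suc i)"] by linarith

lemma tail_size_eq_0: "(\<And>x. x \<in># M \<Longrightarrow> psize x \<le> i) \<Longrightarrow> tail_size M i = 0"
  by (force simp: tail_size_def filter_mset_eq_conv)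

lemma psize_of_columns [simp]: "psize (of_columns M i) = tail_size M i"
  by (simp add: of_columns_def)

lemma overlined_of_columns [simp]: "overlined (of_columns M i) \<longleftrightarrow> Over (Suc i) \<in># M"
  by (simp add: of_columns_def)

lemma opart_eq_iff: "x = y \<longleftrightarrow> psize x = psize y \<and> (overlined x \<longleftrightarrow> overlined y)"
  by (cases x; cases y) auto

lemma mset_psize_bound:
  obtains N where "\<And>x. x \<in># M \<Longrightarrow> psize x \<le> N"
proof -
  have "finite (psize ` set_mset M)" by simp
  then show ?thesis using that by (meson Max_ge imageI)
qed

lemma of_columns_eventually:
  assumes "\<And>x. x \<in># M \<Longrightarrow> psize x \<le> N" "N \<le> i"
  shows "of_columns M i = Plain 0"
proof -
  have "Over (Suc i) \<notin># M" using assms(1)[of "Over (Suc i)"] assms(2) by auto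
  moreover have "tail_size M i = 0" using assms by (intro tail_size_eq_0) (meson order_trans)
  ultimately show ?thesis by (simp add: of_columns_def)
qed

text \<open>A marked column ends in its over-lined row, so this row is strictly larger than the
  next. That gives the order, excludes \<open>Over 0\<close>, and prevents a second over-lined row
  of the same size.\<close>

lemma of_columns_in_overpartitions: "of_columns M \<in> overpartitions"
proof -
  have "of_columns M (Suc i) \<le> of_columns M i" for i
    using tail_size_antimono[of i "Suc i" M] tail_size_less[of i M]
    by (cases "Over (Suc i) \<in># M") (simp_all add: less_eq_opart_def le_less)
  moreover have "of_columns M i \<noteq> Over 0" for i
    using tail_size_less[of i M] by (auto simp: of_columns_def)
  moreover have "finite {i. of_columns M i \<noteq> Plain 0}"
  proof -
    obtain N where "\<And>x. x \<in># M \<Longrightarrow> psize x \<le> N" using mset_psize_bound by blast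
    then have "of_columns M i = Plain 0" if "N \<le> i" for i
      using that by (rule of_columns_eventually)
    then have "{i. of_columns M i \<noteq> Plain 0} \<subseteq> {..<N}" by (auto intro: leI)
    then show ?thesis using finite_subset by blast
  qed
  moreover have "i = j" if ij: "of_columns M i = Over n" "of_columns M j = Over n" for n i j
  proof -
    have *: "tail_size M i = n" "tail_size M j = n" "Over (Suc i) \<in># M" "Over (Suc j) \<in># M"
      using ij by (auto simp: of_columns_def split: if_splits)
    have "\<not> i < j"
      using * tail_size_antimono[of "Suc i" j M] tail_size_less[of i M] by auto
    moreover have "\<not> j < i"
      using * tail_size_antimono[of "Suc j" i M] tail_size_less[of j M] by auto
    ultimately show ?thesis by simp
  qed
  ultimately show ?thesis unfolding overpartitions_def decseq_Suc_iff by blast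
qed

text \<open>As \<open>Over n < Plain n\<close>, a part that follows an over-lined part of the same
  size would be over-lined as well, and the over-lined integer would be repeated. So an over-lined
  part is strictly larger than the next one.\<close>

lemma overpartition_step:
  assumes l: "l \<in> overpartitions"
  shows "psize (l (Suc i)) + of_bool (overlined (l i)) \<le> psize (l i)"
proof -
  have le: "l (Suc i) \<le> l i" using l by (simp add: overpartitions_def decseq_Suc_iff)
  show ?thesis
  proof (cases "overlined (l i) \<and> psize (l (Suc i)) = psize (l i)")
    case True
    then have "overlined (l (Suc i))" using le by (auto simp: less_eq_opart_def)
    then have "l (Suc i) = Over (psize (l i))" "l i = Over (psize (l i))"
      using True by (auto simp: opart_eq_iff)
    then have "Suc i = i" using l unfolding overpartitions_def by blast
    then show ?thesis by simp
  qed (use le in \<open>auto simp: less_eq_opart_def\<close>)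
qed

lemma overpartition_eventually:
  assumes "l \<in> overpartitions"
  obtains N where "\<And>i. N \<le> i \<Longrightarrow> l i = Plain 0"
proof -
  have "finite {i. l i \<noteq> Plain 0}" using assms by (simp add: overpartitions_def)
  then obtain N where "{i. l i \<noteq> Plain 0} \<subseteq> {..<N}" using finite_nat_bounded by blast
  then have "l i = Plain 0" if "N \<le> i" for i using that by (metis (mono_tags, lifting) lessThan_iff mem_Collect_eq not_less subsetD)
  then show ?thesis using that by blast
qed

lemma count_columns:
  assumes l: "l \<in> overpartitions"
  shows "count (columns l) x = column_count l x"
proof -
  obtain N where N: "\<And>i. N \<le> i \<Longrightarrow> l i = Plain 0" using overpartition_eventually[OF l] by blast
  have "{x. 0 < column_count l x} \<subseteq> Over ` {..N} \<union> Plain ` {..N}"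
  proof
    fix x assume x: "x \<in> {x. 0 < column_count l x}"
    have "psize x \<le> N"
    proof (rule ccontr)
      assume "\<not> psize x \<le> N"
      then have "l (psize x - 1) = Plain 0" by (intro N) auto
      then show False using x by (auto simp: column_count_def split: if_splits)
    qed
    then show "x \<in> Over ` {..N} \<union> Plain ` {..N}" by (cases x) auto
  qed
  then have "finite {x. 0 < column_count l x}" by (rule finite_subset) auto
  then show ?thesis by (simp add: columns_def count_Abs_multiset)
qed

lemma in_columns_iff: "l \<in> overpartitions \<Longrightarrow> x \<in># columns l \<longleftrightarrow> 0 < column_count l x"
  by (metis count_columns count_greater_zero_iff)

lemma columns_in_column_msets:
  assumes l: "l \<in> overpartitions"
  shows "columns l \<in> column_msets"
proof -
  have "1 \<le> psize x" if "x \<in># columns l" for x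
    using that by (auto simp: in_columns_iff[OF l] column_count_def split: if_splits)
  then show ?thesis
    by (auto simp: bounded_msets_def count_columns[OF l] column_count_def)
qed

lemma columns_of_columns:
  assumes M: "M \<in> column_msets"
  shows "columns (of_columns M) = M"
proof (rule multiset_eqI)
  fix x
  show "count (columns (of_columns M)) x = count M x"
  proof (cases "psize x")
    case 0
    then have "x \<notin># M" using M by (auto simp: bounded_msets_def)
    then show ?thesis
      using 0 by (simp add: count_columns of_columns_in_overpartitions column_count_def count_eq_zero_iff)
  next
    case (Suc i)
    have le: "count M (Over (Suc i)) \<le> 1" using M by (auto simp: bounded_msets_def)
    have over: "of_bool (Over (Suc i) \<in># M) = count M (Over (Suc i))"
    proof (cases "Over (Suc i) \<in># M")
      case True
      then have "0 < count M (Over (Suc i))" by simp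
      then have "count M (Over (Suc i)) = 1" using le by linarith
      then show ?thesis using True by simp
    qed (simp add: count_eq_zero_iff)
    show ?thesis
    proof (cases x)
      case (Over k)
      then show ?thesis
        using Suc over by (simp add: count_columns of_columns_in_overpartitions column_count_def)
    next
      case (Plain k)
      then show ?thesis
        using Suc over tail_size_Suc[of M i]
        by (simp add: count_columns of_columns_in_overpartitions column_count_def)
    qed
  qed
qed

lemma of_columns_columns:
  assumes l: "l \<in> overpartitions"
  shows "of_columns (columns l) = l"
proof
  fix i
  obtain N1 where N1: "\<And>i. N1 \<le> i \<Longrightarrow> l i = Plain 0" using overpartition_eventually[OF l] by blast
  obtain N2 where N2: "\<And>x. x \<in># columns l \<Longrightarrow> psize x \<le> N2" using mset_psize_bound by blast
  \<comment> \<open>Beyond all nonzero rows and all columns, so the induction runs down from an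
    index where both sides are zero, and at least \<open>i\<close>, so it reaches
    \<open>i\<close>.\<close>
  define N where "N = max i (max N1 N2)"
  have "tail_size (columns l) j = psize (l j)" if "j \<le> N" for j
    using that
  proof (induction j rule: inc_induct)
    case base
    have "tail_size (columns l) N = 0"
      by (rule tail_size_eq_0) (metis N2 N_def le_max_iff_disj)
    then show ?case using N1[of N] by (simp add: N_def)
  next
    case (step j)
    then show ?case
      using tail_size_Suc[of "columns l" j] overpartition_step[OF l, of j]
      by (simp add: count_columns[OF l] column_count_def)
  qed
  moreover have "Over (Suc i) \<in># columns l \<longleftrightarrow> overlined (l i)"
    by (simp add: in_columns_iff[OF l] column_count_def)
  ultimately show "of_columns (columns l) i = l i"
    by (simp add: opart_eq_iff N_def)
qed

lemma of_columns_bij: "bij_betw of_columns column_msets overpartitions"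
  by (rule bij_betw_byWitness[where f' = columns])
    (use columns_of_columns of_columns_columns of_columns_in_overpartitions columns_in_column_msets in blast)+

lemma of_columns_bij_partitions:
  "bij_betw of_columns (bounded_msets {x. 1 \<le> psize x \<and> \<not> overlined x} {x. overlined x}) partitions"
proof (rule bij_betw_subset[OF of_columns_bij])
  let ?D = "bounded_msets {x. 1 \<le> psize x \<and> \<not> overlined x} {x. overlined x}"
  show "?D \<subseteq> column_msets" by (auto simp: bounded_msets_def)
  show "of_columns ` ?D = partitions"
  proof
    show "of_columns ` ?D \<subseteq> partitions"
      using of_columns_in_overpartitions by (auto simp: partitions_def bounded_msets_def)
    show "partitions \<subseteq> of_columns ` ?D"
    proof
      fix l assume "l \<in> partitions"
      then have l: "l \<in> overpartitions" "\<And>i. \<not> overlined (l i)" by (auto simp: partitions_def)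
      have "\<not> overlined x" if "x \<in># columns l" for x
        using that l(2) by (auto simp: in_columns_iff[OF l(1)] column_count_def split: if_splits)
      then have "columns l \<in> ?D" using columns_in_column_msets[OF l(1)] by (auto simp: bounded_msets_def)
      then show "l \<in> of_columns ` ?D" using of_columns_columns[OF l(1)] by (metis imageI)
    qed
  qed
qed

lemma S_weight_of_columns:
  "S_weight S (of_columns M) = (\<Sum>x\<in>#M. \<Sum>i<psize x. S (Suc i))"
proof -
  obtain N where N: "\<And>x. x \<in># M \<Longrightarrow> psize x \<le> N" using mset_psize_bound by blast
  have "S_weight S (of_columns M) = (\<Sum>i<N. psize (of_columns M i) * S (Suc i))"
    unfolding S_weight_def
  proof (rule sum.mono_neutral_left)
    show "{i. of_columns M i \<noteq> Plain 0} \<subseteq> {..<N}"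
      using of_columns_eventually[OF N] by (auto intro: leI)
    show "\<forall>i\<in>{..<N} - {i. of_columns M i \<noteq> Plain 0}. psize (of_columns M i) * S (Suc i) = 0"
      by (auto simp del: psize_of_columns)
  qed simp
  also have "\<dots> = (\<Sum>x\<in>#M. \<Sum>i<psize x. S (Suc i))"
    using N
  proof (induction M)
    case (add x M)
    have tail: "tail_size (add_mset x M) i = tail_size M i + (if i < psize x then 1 else 0)" for i
      by (simp add: tail_size_def)
    have "(\<Sum>i<N. tail_size (add_mset x M) i * S (Suc i)) =
        (\<Sum>i<N. tail_size M i * S (Suc i)) + (\<Sum>i<N. if i < psize x then S (Suc i) else 0)"
      unfolding sum.distrib[symmetric] by (rule sum.cong) (auto simp: tail algebra_simps)
    also have "(\<Sum>i<N. if i < psize x then S (Suc i) else 0) = (\<Sum>i<psize x. S (Suc i))"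
      using add.prems[of x] by (intro sum.mono_neutral_cong_right) auto
    finally show ?case using add by simp
  qed (simp add: tail_size_def)
  finally show ?thesis .
qed

lemma weight_eq_S_weight: "weight l = S_weight (\<lambda>_. 1) l"
  by (simp add: weight_def S_weight_def)

section \<open>Weights that indicate a strictly increasing sequence\<close>

context
  fixes p S :: "nat \<Rightarrow> nat"
  assumes p: "strict_mono p" "p 0 = 1"
    and S: "\<And>i. i \<ge> 1 \<Longrightarrow> S i = (if \<exists>n. i = p n then 1 else 0)"
begin

text \<open>The partial sum up to \<open>k\<close> counts the indices \<open>a\<close> with
  \<open>p a \<le> k\<close>, so it is \<open>n + 1\<close> exactly while \<open>k\<close> lies
  between \<open>p n\<close> and \<open>p (Suc n)\<close>.\<close>

lemma sum_indicator_fibre: "{k. 1 \<le> k \<and> (\<Sum>i<k. S (Suc i)) = Suc n} = {p n..<p (Suc n)}"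
proof -
  have p_less: "p a < p b \<longleftrightarrow> a < b" and p_le: "p a \<le> p b \<longleftrightarrow> a \<le> b" for a b
    using p(1) by (simp_all add: strict_mono_less strict_mono_less_eq)
  have sum: "(\<Sum>i<k. S (Suc i)) = Suc n" if k: "p n \<le> k" "k < p (Suc n)" for k n
  proof -
    have "(\<Sum>i<k. S (Suc i)) = (\<Sum>i\<in>{1..k}. S i)"
      by (rule sum.reindex_bij_witness[of _ "\<lambda>i. i - 1" Suc]) auto
    also have "\<dots> = (\<Sum>i\<in>p ` {..n}. 1)"
    proof (rule sum.mono_neutral_cong_right)
      show "p ` {..n} \<subseteq> {1..k}"
      proof (rule image_subsetI)
        fix a assume "a \<in> {..n}"
        then have "1 \<le> p a" "p a \<le> p n" using p_le[of 0 a] p_le[of a n] p(2) by auto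
        then show "p a \<in> {1..k}" using k by simp
      qed
      show "\<forall>i\<in>{1..k} - p ` {..n}. S i = 0"
      proof
        fix i assume i: "i \<in> {1..k} - p ` {..n}"
        have "i \<noteq> p a" for a
        proof
          assume "i = p a"
          moreover from this have "p a < p (Suc n)" using i k by auto
          ultimately show False using i p_less by auto
        qed
        then show "S i = 0" using i S by auto
      qed
      show "S i = 1" if "i \<in> p ` {..n}" for i
      proof -
        obtain a where "i = p a" using \<open>i \<in> p ` {..n}\<close> by blast
        then show ?thesis using S[of i] p_le[of 0 a] p(2) by auto
      qed
    qed simp
    also have "\<dots> = Suc n"
      using strict_mono_imp_inj_on[OF p(1)] by (simp add: card_image)
    finally show ?thesis .
  qed
  have "p m \<le> k \<and> k < p (Suc m)" if k: "1 \<le> k" "(\<Sum>i<k. S (Suc i)) = Suc m" for k m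
  proof -
    obtain a where "p a \<le> k" "k < p (Suc a)"
    proof -
      have "\<exists>b. k < p b" using strict_mono_imp_increasing[OF p(1), of "Suc k"] by (intro exI[of _ "Suc k"]) auto
      \<comment> \<open>This \<open>b\<close> is not \<open>0\<close> because
        \<open>p 0 = 1 \<le> k\<close>; its predecessor gives the two values of \<open>p\<close>
        that enclose \<open>k\<close>.\<close>
      define b where "b = (LEAST b. k < p b)"
      have b: "k < p b" "\<And>c. c < b \<Longrightarrow> \<not> k < p c"
        unfolding b_def using \<open>\<exists>b. k < p b\<close> by (auto intro: LeastI_ex dest: not_less_Least)
      then obtain a where "b = Suc a" using k p(2) by (cases b) auto
      then show ?thesis using b(1) b(2)[of a] that[of a] by simp
    qed
    then show ?thesis using sum[of a k] k by simp
  qed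
  moreover have "1 \<le> k" if "p n \<le> k" for k using that p_le[of 0 n] p(2) by simp
  ultimately show ?thesis using sum unfolding set_eq_iff mem_Collect_eq atLeastLessThan_iff by blast
qed

text \<open>The first row has weight \<open>1\<close>, so no nonempty column is free of charge; free
  columns would make the fibres of the weight infinite.\<close>

lemma sum_indicator_pos: "1 \<le> k \<Longrightarrow> 1 \<le> (\<Sum>i<k. S (Suc i))"
proof -
  assume "1 \<le> k"
  moreover have "S 1 = 1" using S[of 1] p(2) by (metis le_refl)
  ultimately have "S (Suc 0) \<le> (\<Sum>i<k. S (Suc i))" by (intro member_le_sum) auto
  then show ?thesis using \<open>S 1 = 1\<close> by simp
qed

lemma column_fibres:
  "{x. 1 \<le> psize x \<and> overlined x \<and> (\<Sum>i<psize x. S (Suc i)) = Suc n} = Over ` {p n..<p (Suc n)}"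
  "{x. 1 \<le> psize x \<and> \<not> overlined x \<and> (\<Sum>i<psize x. S (Suc i)) = Suc n} = Plain ` {p n..<p (Suc n)}"
proof -
  have *: "1 \<le> k \<and> (\<Sum>i<k. S (Suc i)) = Suc n \<longleftrightarrow> k \<in> {p n..<p (Suc n)}" for k
    using sum_indicator_fibre by blast
  have "x \<in> {x. 1 \<le> psize x \<and> overlined x \<and> (\<Sum>i<psize x. S (Suc i)) = Suc n} \<longleftrightarrow>
      x \<in> Over ` {p n..<p (Suc n)}" for x
    by (cases x) (use *[of "psize x"] in auto)
  moreover have "x \<in> {x. 1 \<le> psize x \<and> \<not> overlined x \<and> (\<Sum>i<psize x. S (Suc i)) = Suc n} \<longleftrightarrow>
      x \<in> Plain ` {p n..<p (Suc n)}" for x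
    by (cases x) (use *[of "psize x"] in auto)
  ultimately show
    "{x. 1 \<le> psize x \<and> overlined x \<and> (\<Sum>i<psize x. S (Suc i)) = Suc n} = Over ` {p n..<p (Suc n)}"
    "{x. 1 \<le> psize x \<and> \<not> overlined x \<and> (\<Sum>i<psize x. S (Suc i)) = Suc n} = Plain ` {p n..<p (Suc n)}"
    by blast+
qed

lemma finite_column_fibre: "finite {x. 1 \<le> psize x \<and> (\<Sum>i<psize x. S (Suc i)) = n}"
proof (cases n)
  case 0
  then have "{x. 1 \<le> psize x \<and> (\<Sum>i<psize x. S (Suc i)) = n} = {}"
    using sum_indicator_pos by force
  then show ?thesis by (simp only: finite.emptyI)
next
  case (Suc m)
  have "{x. 1 \<le> psize x \<and> (\<Sum>i<psize x. S (Suc i)) = n} \<subseteq>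
      Over ` {p m..<p (Suc m)} \<union> Plain ` {p m..<p (Suc m)}"
    unfolding column_fibres[symmetric] Suc by blast
  then show ?thesis by (rule finite_subset) auto
qed

text \<open>Each height offers one marked and one unmarked kind of column, so the two factors carry
  the same exponent.\<close>

lemma has_gf_overpartitions:
  defines "f \<equiv> \<lambda>n. (1 + fps_X ^ Suc n) ^ (p (Suc n) - p n) * geom (Suc n) ^ (p (Suc n) - p n)"
  shows "f has_prod prodinf f" "has_gf overpartitions (S_weight S) (prodinf f)"
proof -
  let ?h = "\<lambda>x. \<Sum>i<psize x. S (Suc i)"
  let ?I = "{x. 1 \<le> psize x}" and ?B = "{x. overlined x}"
  have "{x \<in> ?I \<inter> ?B. ?h x = Suc n} = Over ` {p n..<p (Suc n)}"
    "{x \<in> ?I - ?B. ?h x = Suc n} = Plain ` {p n..<p (Suc n)}" for n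
    using column_fibres[of n] by auto
  then have card: "card {x \<in> ?I \<inter> ?B. ?h x = Suc n} = p (Suc n) - p n"
    "card {x \<in> ?I - ?B. ?h x = Suc n} = p (Suc n) - p n" for n
    by (simp_all add: card_image inj_on_def)
  have "finite {x \<in> ?I. ?h x = n}" for n using finite_column_fibre unfolding mem_Collect_eq .
  note gf = has_gf_bounded_msets[of ?I ?h ?B, OF _ this, unfolded card, folded f_def]
  show "f has_prod prodinf f" using sum_indicator_pos by (intro gf) auto
  have "has_gf column_msets (\<lambda>M. \<Sum>x\<in>#M. ?h x) (prodinf f)"
    using sum_indicator_pos by (intro gf) auto
  then show "has_gf overpartitions (S_weight S) (prodinf f)"
    by (rule has_gf_bij[OF of_columns_bij, rotated]) (rule S_weight_of_columns)
qed

lemma has_gf_partitions: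
  defines "f \<equiv> \<lambda>n. geom (Suc n) ^ (p (Suc n) - p n)"
  shows "f has_prod prodinf f" "has_gf partitions (S_weight S) (prodinf f)"
proof -
  let ?h = "\<lambda>x. \<Sum>i<psize x. S (Suc i)"
  let ?I = "{x. 1 \<le> psize x \<and> \<not> overlined x}" and ?B = "{x. overlined x}"
  have "{x \<in> ?I \<inter> ?B. ?h x = Suc n} = {}"
    "{x \<in> ?I - ?B. ?h x = Suc n} = Plain ` {p n..<p (Suc n)}" for n
    using column_fibres[of n] by auto
  then have card: "card {x \<in> ?I \<inter> ?B. ?h x = Suc n} = 0"
    "card {x \<in> ?I - ?B. ?h x = Suc n} = p (Suc n) - p n" for n
    by (simp_all add: card_image inj_on_def)
  have "finite {x \<in> ?I. ?h x = n}" for n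
    by (rule finite_subset[OF _ finite_column_fibre[of n]]) auto
  note gf = has_gf_bounded_msets[of ?I ?h ?B, OF _ this, unfolded card power_0 mult_1_left, folded f_def]
  show "f has_prod prodinf f" using sum_indicator_pos by (intro gf) auto
  have "has_gf (bounded_msets ?I ?B) (\<lambda>M. \<Sum>x\<in>#M. ?h x) (prodinf f)"
    using sum_indicator_pos by (intro gf) auto
  then show "has_gf partitions (S_weight S) (prodinf f)"
    by (rule has_gf_bij[OF of_columns_bij_partitions, rotated]) (rule S_weight_of_columns)
qed

end
section \<open>The identities\<close>

lemma colored_overpartitions_eq:
  "colored_overpartitions C = bounded_msets {(x, k). 1 \<le> psize x \<and> k < C (psize x)} {(x, k :: nat). overlined x}"
proof -
  have "(\<forall>y\<in>{(x, k :: nat). overlined x}. count M y \<le> 1) \<longleftrightarrow> (\<forall>n k. count M (Over n, k) \<le> 1)" for M :: "(opart \<times> nat) multiset"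
  proof (intro iffI ballI)
    fix y assume "\<forall>n k. count M (Over n, k) \<le> 1" "y \<in> {(x, k :: nat). overlined x}"
    then show "count M y \<le> 1" by (cases y; cases "fst y") auto
  qed auto
  then show ?thesis by (auto simp: colored_overpartitions_def bounded_msets_def)
qed

lemma has_gf_colored_overpartitions:
  "has_gf (colored_overpartitions C) colored_weight
    (\<Prod>n. (1 + fps_X ^ Suc n) ^ C (Suc n) * geom (Suc n) ^ C (Suc n))"
proof -
  let ?h = "\<lambda>(x, k). psize x"
  let ?I = "{(x, k :: nat). 1 \<le> psize x \<and> k < C (psize x)}" and ?B = "{(x, k :: nat). overlined x}"
  have Over: "{y \<in> ?I \<inter> ?B. ?h y = Suc n} = Pair (Over (Suc n)) ` {..<C (Suc n)}" for n
  proof -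
    have "(x, k) \<in> {y \<in> ?I \<inter> ?B. ?h y = Suc n} \<longleftrightarrow> (x, k) \<in> Pair (Over (Suc n)) ` {..<C (Suc n)}" for x k
      by (cases x) auto
    then show ?thesis unfolding set_eq_iff split_paired_All by blast
  qed
  have Plain: "{y \<in> ?I - ?B. ?h y = Suc n} = Pair (Plain (Suc n)) ` {..<C (Suc n)}" for n
  proof -
    have "(x, k) \<in> {y \<in> ?I - ?B. ?h y = Suc n} \<longleftrightarrow> (x, k) \<in> Pair (Plain (Suc n)) ` {..<C (Suc n)}" for x k
      by (cases x) auto
    then show ?thesis unfolding set_eq_iff split_paired_All by blast
  qed
  have card: "card {y \<in> ?I \<inter> ?B. ?h y = Suc n} = C (Suc n)"
    "card {y \<in> ?I - ?B. ?h y = Suc n} = C (Suc n)" for n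
    unfolding Over Plain by (simp_all add: card_image inj_on_def)
  have fin: "finite {y \<in> ?I. ?h y = n}" for n
  proof (cases n)
    case 0
    then have "{y \<in> ?I. ?h y = n} = {}" by auto
    then show ?thesis by (simp only: finite.emptyI)
  next
    case (Suc m)
    have "{y \<in> ?I. ?h y = n} = {y \<in> ?I \<inter> ?B. ?h y = Suc m} \<union> {y \<in> ?I - ?B. ?h y = Suc m}"
      unfolding Suc by blast
    then show ?thesis unfolding Over Plain by simp
  qed
  have "has_gf (bounded_msets ?I ?B) (\<lambda>M. \<Sum>y\<in>#M. ?h y)
      (\<Prod>n. (1 + fps_X ^ Suc n) ^ C (Suc n) * geom (Suc n) ^ C (Suc n))"
    by (rule has_gf_bounded_msets(2)[of ?I ?h ?B, OF _ fin, unfolded card]) auto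
  then show ?thesis
    unfolding colored_overpartitions_eq by (simp add: has_gf_def colored_weight_def)
qed

section \<open>Series of partitions and products of known series\<close>

lemma one_over_power_eq_geom: "1 / (1 - fps_X ^ Suc n) ^ c = geom (Suc n) ^ c"
proof -
  have "((1 - fps_X ^ Suc n) ^ c :: rat fps) $ 0 = 1"
    by (simp add: fps_nth_power_0 del: power_Suc)
  then have "1 / (1 - fps_X ^ Suc n) ^ c = inverse ((1 - fps_X ^ Suc n) ^ c :: rat fps)"
    by (simp add: fps_divide_unit del: power_Suc)
  then show ?thesis by (simp only: fps_inverse_power geom_def)
qed

lemma quotient_power_eq_geom:
  "((1 + fps_X ^ Suc n) / (1 - fps_X ^ Suc n)) ^ c = (1 + fps_X ^ Suc n) ^ c * geom (Suc n) ^ c"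
proof -
  have "(1 - fps_X ^ Suc n :: rat fps) $ 0 \<noteq> 0"
    by (simp del: power_Suc)
  then have "(1 + fps_X ^ Suc n) / (1 - fps_X ^ Suc n) = (1 + fps_X ^ Suc n) * geom (Suc n)"
    unfolding geom_def by (rule fps_divide_unit)
  then show ?thesis by (simp only: power_mult_distrib)
qed

lemma qq_inf_has_prod: "(\<lambda>k. 1 - fps_X ^ Suc k) has_prod qq_inf" "qq_inf $ 0 = 1"
proof -
  have "fps_X ^ Suc n dvd (1 - fps_X ^ Suc n :: rat fps) - 1" for n by simp
  from has_prod_prodinf_fps[of "\<lambda>k. 1 - fps_X ^ Suc k", OF this]
    prodinf_fps_nth_0[of "\<lambda>k. 1 - fps_X ^ Suc k", OF this]
  show "(\<lambda>k. 1 - fps_X ^ Suc k) has_prod qq_inf" "qq_inf $ 0 = 1"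
    by (simp_all only: qq_inf_def)
qed

lemma geom_has_prod: "(\<lambda>k. geom (Suc k)) has_prod (1 / qq_inf)"
  using has_prod_inverse_fps[OF qq_inf_has_prod(1)] qq_inf_has_prod(2)
  by (simp only: geom_def fps_divide_unit mult_1_left zero_neq_one not_False_eq_True)

text \<open>The ordinary weight is the weight for the constant sequence \<open>1\<close>, which
  indicates the values of \<open>Suc\<close>; all gaps are \<open>1\<close>, so Euler's product is a
  special case.\<close>

lemma has_gf_partitions_weight: "has_gf partitions weight (1 / qq_inf)"
proof -
  have "has_gf partitions (S_weight (\<lambda>_. 1)) (\<Prod>n. geom (Suc n) ^ (Suc (Suc n) - Suc n))"
  proof (rule has_gf_partitions(2)[where p = Suc])
    show "1 = (if \<exists>n. i = Suc n then 1 else 0 :: nat)" if "1 \<le> i" for i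
      using that by (cases i) auto
  qed (auto simp: strict_mono_def)
  moreover have "(\<Prod>n. geom (Suc n) ^ (Suc (Suc n) - Suc n)) = 1 / qq_inf"
    using has_prod_unique[OF geom_has_prod] by simp
  ultimately show ?thesis by (simp add: has_gf_def weight_eq_S_weight)
qed

context
  fixes P :: "rat fps"
  defines "P \<equiv> \<Prod>n. geom (Suc n) ^ Suc n"
begin

lemma P_has_prod: "(\<lambda>n. geom (Suc n) ^ Suc n) has_prod P"
  unfolding P_def by (rule macmahon(1))

lemma P_nonzero: "P \<noteq> 0"
proof -
  have "P $ 0 = 1"
    unfolding P_def
    by (intro prodinf_fps_nth_0 dvd_power_minus_one X_power_dvd_geom_minus_one)
  then show ?thesis by auto
qed

lemma qq_inf_inverse_nonzero: "1 / qq_inf \<noteq> 0"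
proof -
  have "qq_inf \<noteq> 0" using qq_inf_has_prod(2) by auto
  then show ?thesis using qq_inf_has_prod(2) by (simp add: fps_divide_unit)
qed

text \<open>The exponent \<open>n + 2\<close> is the gap after the triangular number
  \<open>(n + 1) * (n + 2) div 2\<close>; one factor \<open>geom (Suc n)\<close> is split off for
  the partition.\<close>

lemma prodinf_geom_pairs: "(\<Prod>n. geom (Suc n) ^ (n + 2)) = 1 / qq_inf * P"
proof -
  have "(\<lambda>n. geom (Suc n) * geom (Suc n) ^ Suc n) has_prod (1 / qq_inf * P)"
    by (intro has_prod_mult_fps geom_has_prod P_has_prod P_nonzero qq_inf_inverse_nonzero)
  from has_prod_unique[OF this] show ?thesis by simp
qed

text \<open>The exponent \<open>2 * n + 3\<close> is the gap between the squares of
  \<open>n + 1\<close> and \<open>n + 2\<close>, split into one factor for the partition and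
  \<open>n + 1\<close> for each plane partition.\<close>

lemma prodinf_geom_triples: "(\<Prod>n. geom (Suc n) ^ (2 * n + 3)) = 1 / qq_inf * P ^ 2"
proof -
  have "(\<lambda>n. geom (Suc n) * (geom (Suc n) ^ Suc n * geom (Suc n) ^ Suc n)) has_prod (1 / qq_inf * (P * P))"
    by (intro has_prod_mult_fps geom_has_prod P_has_prod P_nonzero qq_inf_inverse_nonzero no_zero_divisors)
  moreover have "geom (Suc n) * (geom (Suc n) ^ Suc n * geom (Suc n) ^ Suc n) = geom (Suc n) ^ (2 * n + 3)" for n
  proof -
    have "2 * n + 3 = Suc (Suc n + Suc n)" by simp
    then show ?thesis by (simp only: power_Suc power_add)
  qed
  ultimately show ?thesis by (simp only: has_prod_unique[symmetric] power2_eq_square)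
qed

end

section \<open>The five special sequences\<close>

lemma ex_ge_1_iff_ex_Suc: "(\<exists>n\<ge>1. P n) \<longleftrightarrow> (\<exists>n. P (Suc n))"
  by (metis One_nat_def Suc_le_D le_add1 plus_1_eq_Suc)

lemma convergent_prodI: "f has_prod F \<Longrightarrow> convergent_prod f"
  by (auto simp: has_prod_def convergent_prod_def)

lemma has_gf_partitions_central_polygonal:
  assumes S: "\<forall>i\<ge>1. S i = (if \<exists>n\<ge>1. i = n * (n - 1) div 2 + 1 then 1 else 0)"
  shows "has_gf partitions (S_weight S) (\<Prod>n. geom (Suc n) ^ Suc n)"
proof -
  define p where "p n = Suc n * n div 2 + 1" for n :: nat
  \<comment> \<open>The numerators differ by an even number, so the difference passes through
    \<open>div 2\<close> without a parity argument.\<close>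
  have diff: "p (Suc n) = p n + Suc n" for n
  proof -
    have "Suc (Suc n) * Suc n = Suc n * n + 2 * Suc n" by simp
    then show ?thesis unfolding p_def by (simp only: div_mult_self2)
  qed
  have "has_gf partitions (S_weight S) (\<Prod>n. geom (Suc n) ^ (p (Suc n) - p n))"
  proof (rule has_gf_partitions(2))
    show "S i = (if \<exists>n. i = p n then 1 else 0)" if "1 \<le> i" for i
      using S that unfolding ex_ge_1_iff_ex_Suc by (simp add: p_def)
  qed (simp_all add: strict_mono_Suc_iff diff, simp add: p_def)
  then show ?thesis by (simp only: diff diff_add_inverse)
qed

lemma has_gf_partitions_triangular:
  assumes S: "\<forall>i\<ge>1. S i = (if \<exists>n\<ge>1. i = n * (n + 1) div 2 then 1 else 0)"
  shows "has_gf partitions (S_weight S) (\<Prod>n. geom (Suc n) ^ (n + 2))"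
proof -
  define p where "p n = Suc n * (Suc n + 1) div 2" for n :: nat
  have diff: "p (Suc n) = p n + (n + 2)" for n
  proof -
    have "Suc (Suc n) * (Suc (Suc n) + 1) = Suc n * (Suc n + 1) + 2 * (n + 2)" by simp
    then show ?thesis unfolding p_def by (simp only: div_mult_self2)
  qed
  have "has_gf partitions (S_weight S) (\<Prod>n. geom (Suc n) ^ (p (Suc n) - p n))"
  proof (rule has_gf_partitions(2))
    show "S i = (if \<exists>n. i = p n then 1 else 0)" if "1 \<le> i" for i
      using S that unfolding ex_ge_1_iff_ex_Suc by (simp add: p_def)
  qed (simp_all add: strict_mono_Suc_iff diff, simp add: p_def)
  then show ?thesis by (simp only: diff diff_add_inverse)
qed

lemma has_gf_partitions_square:
  assumes S: "\<forall>i\<ge>1. S i = (if \<exists>n\<ge>1. i = n ^ 2 then 1 else 0)"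
  shows "has_gf partitions (S_weight S) (\<Prod>n. geom (Suc n) ^ (2 * n + 3))"
proof -
  define p where "p n = (Suc n)\<^sup>2" for n :: nat
  have diff: "p (Suc n) = p n + (2 * n + 3)" for n
    by (simp add: p_def power2_eq_square)
  have "has_gf partitions (S_weight S) (\<Prod>n. geom (Suc n) ^ (p (Suc n) - p n))"
  proof (rule has_gf_partitions(2))
    show "S i = (if \<exists>n. i = p n then 1 else 0)" if "1 \<le> i" for i
      using S that unfolding ex_ge_1_iff_ex_Suc by (simp add: p_def)
  qed (simp_all add: strict_mono_Suc_iff diff, simp add: p_def)
  then show ?thesis by (simp only: diff diff_add_inverse)
qed

text \<open>Both sides are multisets with \<open>C (Suc n)\<close> marked and as many unmarked kinds
  of elements of weight \<open>n + 1\<close>: column heights in the gap of \<open>p\<close> on one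
  side, colors of the integer \<open>n + 1\<close> on the other.\<close>

lemma overpartitions_colored:
  assumes S: "\<And>i. 1 \<le> i \<Longrightarrow> S i = (if \<exists>n. i = p n then 1 else 0)"
    and p: "p 0 = 1" "\<And>n. p (Suc n) = p n + C (Suc n)" and C: "\<And>n. 0 < C (Suc n)"
  defines "f \<equiv> \<lambda>n. ((1 + fps_X ^ Suc n) / (1 - fps_X ^ Suc n)) ^ C (Suc n) :: rat fps"
  shows "equinumerous_finite {l \<in> overpartitions. S_weight S l = m}
      {M \<in> colored_overpartitions C. colored_weight M = m} \<and>
    convergent_prod f \<and>
    ((\<lambda>l. fps_X ^ S_weight S l :: rat fps) has_sum prodinf f) overpartitions"
proof -
  have p_mono: "strict_mono p" using C by (simp add: strict_mono_Suc_iff p)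
  have f: "f = (\<lambda>n. (1 + fps_X ^ Suc n) ^ C (Suc n) * geom (Suc n) ^ C (Suc n))"
    unfolding f_def quotient_power_eq_geom ..
  note gf = has_gf_overpartitions[OF p_mono p(1) S, simplified, unfolded p(2) diff_add_inverse, folded power_Suc, folded f]
  show ?thesis
    using has_gf_equinumerous[OF gf(2) has_gf_colored_overpartitions[of C, folded f]]
      convergent_prodI[OF gf(1)] has_gf_has_sum[OF gf(2)] by blast
qed

lemma partitions_plane_partitions:
  assumes S: "\<forall>i\<ge>1. S i = (if \<exists>n\<ge>1. i = n * (n - 1) div 2 + 1 then 1 else 0)"
  shows "equinumerous_finite {l \<in> partitions. S_weight S l = m}
        {p \<in> plane_partitions. plane_weight p = m} \<and>
      convergent_prod (\<lambda>n. 1 / (1 - fps_X ^ Suc n) ^ Suc n :: rat fps) \<and>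
      ((\<lambda>l. fps_X ^ S_weight S l :: rat fps) has_sum
        (\<Prod>n. 1 / (1 - fps_X ^ Suc n) ^ Suc n)) partitions"
proof -
  note mac = macmahon[folded one_over_power_eq_geom]
  note gf = has_gf_partitions_central_polygonal[OF S, folded one_over_power_eq_geom]
  show ?thesis
    by (intro conjI has_gf_equinumerous[OF gf mac(2)] convergent_prodI[OF mac(1)] has_gf_has_sum[OF gf])
qed

lemma partitions_pairs:
  assumes S: "\<forall>i\<ge>1. S i = (if \<exists>n\<ge>1. i = n * (n + 1) div 2 then 1 else 0)"
  shows "equinumerous_finite {l \<in> partitions. S_weight S l = m}
        {(\<mu>, \<nu>). \<mu> \<in> partitions \<and> \<nu> \<in> plane_partitions \<and> weight \<mu> + plane_weight \<nu> = m} \<and>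
      convergent_prod (\<lambda>k. 1 - fps_X ^ Suc k :: rat fps) \<and>
      convergent_prod (\<lambda>n. 1 / (1 - fps_X ^ Suc n) ^ Suc n :: rat fps) \<and>
      ((\<lambda>l. fps_X ^ S_weight S l :: rat fps) has_sum
        (1 / qq_inf * (\<Prod>n. 1 / (1 - fps_X ^ Suc n) ^ Suc n))) partitions"
proof -
  note mac = macmahon[folded one_over_power_eq_geom]
  note gf = has_gf_partitions_triangular[OF S, unfolded prodinf_geom_pairs, folded one_over_power_eq_geom]
  have "{(\<mu>, \<nu>). \<mu> \<in> partitions \<and> \<nu> \<in> plane_partitions \<and> weight \<mu> + plane_weight \<nu> = m} =
      {x \<in> partitions \<times> plane_partitions. (case x of (\<mu>, \<nu>) \<Rightarrow> weight \<mu> + plane_weight \<nu>) = m}"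
    by auto
  then have "equinumerous_finite {l \<in> partitions. S_weight S l = m}
      {(\<mu>, \<nu>). \<mu> \<in> partitions \<and> \<nu> \<in> plane_partitions \<and> weight \<mu> + plane_weight \<nu> = m}"
    using has_gf_equinumerous[OF gf has_gf_times[OF has_gf_partitions_weight mac(2)]] by simp
  then show ?thesis
    by (intro conjI convergent_prodI[OF mac(1)] convergent_prodI[OF qq_inf_has_prod(1)] has_gf_has_sum[OF gf])
qed

lemma partitions_triples:
  assumes S: "\<forall>i\<ge>1. S i = (if \<exists>n\<ge>1. i = n ^ 2 then 1 else 0)"
  shows "equinumerous_finite {l \<in> partitions. S_weight S l = m}
        {(\<mu>, \<nu>, \<kappa>). \<mu> \<in> partitions \<and> \<nu> \<in> plane_partitions \<and> \<kappa> \<in> plane_partitions \<and>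
           weight \<mu> + plane_weight \<nu> + plane_weight \<kappa> = m} \<and>
      convergent_prod (\<lambda>k. 1 - fps_X ^ Suc k :: rat fps) \<and>
      convergent_prod (\<lambda>n. 1 / (1 - fps_X ^ Suc n) ^ Suc n :: rat fps) \<and>
      ((\<lambda>l. fps_X ^ S_weight S l :: rat fps) has_sum
        (1 / qq_inf * (\<Prod>n. 1 / (1 - fps_X ^ Suc n) ^ Suc n) ^ 2)) partitions"
proof -
  note mac = macmahon[folded one_over_power_eq_geom]
  note gf = has_gf_partitions_square[OF S, unfolded prodinf_geom_triples, folded one_over_power_eq_geom]
  have "has_gf (partitions \<times> plane_partitions \<times> plane_partitions)
      (\<lambda>(\<mu>, x). weight \<mu> + (case x of (\<nu>, \<kappa>) \<Rightarrow> plane_weight \<nu> + plane_weight \<kappa>))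
      (1 / qq_inf * (\<Prod>n. 1 / (1 - fps_X ^ Suc n) ^ Suc n) ^ 2)"
    unfolding power2_eq_square by (intro has_gf_times has_gf_partitions_weight mac(2))
  note eq = has_gf_equinumerous[OF gf this, of m]
  have "{(\<mu>, \<nu>, \<kappa>). \<mu> \<in> partitions \<and> \<nu> \<in> plane_partitions \<and> \<kappa> \<in> plane_partitions \<and>
        weight \<mu> + plane_weight \<nu> + plane_weight \<kappa> = m} =
      {y \<in> partitions \<times> plane_partitions \<times> plane_partitions.
        (case y of (\<mu>, x) \<Rightarrow> weight \<mu> + (case x of (\<nu>, \<kappa>) \<Rightarrow> plane_weight \<nu> + plane_weight \<kappa>)) = m}"
    by auto
  with eq have "equinumerous_finite {l \<in> partitions. S_weight S l = m}
      {(\<mu>, \<nu>, \<kappa>). \<mu> \<in> partitions \<and> \<nu> \<in> plane_partitions \<and> \<kappa> \<in> plane_partitions \<and>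
        weight \<mu> + plane_weight \<nu> + plane_weight \<kappa> = m}"
    by simp
  then show ?thesis
    by (intro conjI convergent_prodI[OF mac(1)] convergent_prodI[OF qq_inf_has_prod(1)] has_gf_has_sum[OF gf])
qed

text \<open>Starting at \<open>fib 2 = 1\<close> skips the repeated value \<open>1\<close> and makes
  \<open>p\<close> strictly increasing; by the recurrence the gap from \<open>fib (n + 2)\<close> to
  \<open>fib (n + 3)\<close> is \<open>fib (n + 1)\<close>, the number of colors of
  \<open>n + 1\<close>.\<close>

lemma overpartitions_fib_colors:
  assumes S: "\<forall>i\<ge>1. S i = (if \<exists>n\<ge>1. i = fib (n + 1) then 1 else 0)"
  shows "equinumerous_finite {l \<in> overpartitions. S_weight S l = m}
        {M \<in> colored_overpartitions fib. colored_weight M = m} \<and>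
      convergent_prod (\<lambda>n. ((1 + fps_X ^ Suc n) / (1 - fps_X ^ Suc n)) ^ fib (Suc n) :: rat fps) \<and>
      ((\<lambda>l. fps_X ^ S_weight S l :: rat fps) has_sum
        (\<Prod>n. ((1 + fps_X ^ Suc n) / (1 - fps_X ^ Suc n)) ^ fib (Suc n))) overpartitions"
proof (rule overpartitions_colored[where p = "\<lambda>n. fib (n + 2)"])
  show "S i = (if \<exists>n. i = fib (n + 2) then 1 else 0)" if "1 \<le> i" for i
    using S that unfolding ex_ge_1_iff_ex_Suc by simp
qed (simp_all add: fib_neq_0_nat numeral_2_eq_2)

text \<open>The gap from \<open>2 ^ n\<close> to \<open>2 ^ (n + 1)\<close> is \<open>2 ^ n\<close>,
  the number of colors of \<open>n + 1\<close>.\<close>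

lemma overpartitions_power_two_colors:
  assumes S: "\<forall>i\<ge>1. S i = (if \<exists>n\<ge>1. i = 2 ^ (n - 1) then 1 else 0)"
  shows "equinumerous_finite {l \<in> overpartitions. S_weight S l = m}
        {M \<in> colored_overpartitions (\<lambda>i. 2 ^ (i - 1)). colored_weight M = m} \<and>
      convergent_prod (\<lambda>n. ((1 + fps_X ^ Suc n) / (1 - fps_X ^ Suc n)) ^ (2 ^ (Suc n - 1)) :: rat fps) \<and>
      ((\<lambda>l. fps_X ^ S_weight S l :: rat fps) has_sum
        (\<Prod>n. ((1 + fps_X ^ Suc n) / (1 - fps_X ^ Suc n)) ^ (2 ^ (Suc n - 1)))) overpartitions"
proof (rule overpartitions_colored[where p = "\<lambda>n. 2 ^ n"])
  show "S i = (if \<exists>n. i = 2 ^ n then 1 else 0)" if "1 \<le> i" for i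
    using S that unfolding ex_ge_1_iff_ex_Suc by simp
qed simp_all

theorem corollary1p13:
  fixes S :: "nat \<Rightarrow> nat" and m :: nat
  shows
   "((\<forall>i\<ge>1. S i = (if \<exists>n\<ge>1. i = n * (n - 1) div 2 + 1 then 1 else 0)) \<longrightarrow>
      equinumerous_finite {l \<in> partitions. S_weight S l = m}
        {p \<in> plane_partitions. plane_weight p = m} \<and>
      convergent_prod (\<lambda>n. 1 / (1 - fps_X ^ Suc n) ^ Suc n :: rat fps) \<and>
      ((\<lambda>l. fps_X ^ S_weight S l :: rat fps) has_sum
        (\<Prod>n. 1 / (1 - fps_X ^ Suc n) ^ Suc n)) partitions)
    \<and>
    ((\<forall>i\<ge>1. S i = (if \<exists>n\<ge>1. i = n * (n + 1) div 2 then 1 else 0)) \<longrightarrow>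
      equinumerous_finite {l \<in> partitions. S_weight S l = m}
        {(\<mu>, \<nu>). \<mu> \<in> partitions \<and> \<nu> \<in> plane_partitions \<and> weight \<mu> + plane_weight \<nu> = m} \<and>
      convergent_prod (\<lambda>k. 1 - fps_X ^ Suc k :: rat fps) \<and>
      convergent_prod (\<lambda>n. 1 / (1 - fps_X ^ Suc n) ^ Suc n :: rat fps) \<and>
      ((\<lambda>l. fps_X ^ S_weight S l :: rat fps) has_sum
        (1 / qq_inf * (\<Prod>n. 1 / (1 - fps_X ^ Suc n) ^ Suc n))) partitions)
    \<and>
    ((\<forall>i\<ge>1. S i = (if \<exists>n\<ge>1. i = n ^ 2 then 1 else 0)) \<longrightarrow>
      equinumerous_finite {l \<in> partitions. S_weight S l = m}
        {(\<mu>, \<nu>, \<kappa>). \<mu> \<in> partitions \<and> \<nu> \<in> plane_partitions \<and> \<kappa> \<in> plane_partitions \<and>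
           weight \<mu> + plane_weight \<nu> + plane_weight \<kappa> = m} \<and>
      convergent_prod (\<lambda>k. 1 - fps_X ^ Suc k :: rat fps) \<and>
      convergent_prod (\<lambda>n. 1 / (1 - fps_X ^ Suc n) ^ Suc n :: rat fps) \<and>
      ((\<lambda>l. fps_X ^ S_weight S l :: rat fps) has_sum
        (1 / qq_inf * (\<Prod>n. 1 / (1 - fps_X ^ Suc n) ^ Suc n) ^ 2)) partitions)
    \<and>
    ((\<forall>i\<ge>1. S i = (if \<exists>n\<ge>1. i = fib (n + 1) then 1 else 0)) \<longrightarrow>
      equinumerous_finite {l \<in> overpartitions. S_weight S l = m}
        {M \<in> colored_overpartitions fib. colored_weight M = m} \<and>
      convergent_prod (\<lambda>n. ((1 + fps_X ^ Suc n) / (1 - fps_X ^ Suc n)) ^ fib (Suc n) :: rat fps) \<and>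
      ((\<lambda>l. fps_X ^ S_weight S l :: rat fps) has_sum
        (\<Prod>n. ((1 + fps_X ^ Suc n) / (1 - fps_X ^ Suc n)) ^ fib (Suc n))) overpartitions)
    \<and>
    ((\<forall>i\<ge>1. S i = (if \<exists>n\<ge>1. i = 2 ^ (n - 1) then 1 else 0)) \<longrightarrow>
      equinumerous_finite {l \<in> overpartitions. S_weight S l = m}
        {M \<in> colored_overpartitions (\<lambda>i. 2 ^ (i - 1)). colored_weight M = m} \<and>
      convergent_prod (\<lambda>n. ((1 + fps_X ^ Suc n) / (1 - fps_X ^ Suc n)) ^ (2 ^ (Suc n - 1)) :: rat fps) \<and>
      ((\<lambda>l. fps_X ^ S_weight S l :: rat fps) has_sum
        (\<Prod>n. ((1 + fps_X ^ Suc n) / (1 - fps_X ^ Suc n)) ^ (2 ^ (Suc n - 1)))) overpartitions)"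
  by (intro conjI; rule impI; 
      rule partitions_plane_partitions partitions_pairs partitions_triples overpartitions_fib_colors
        overpartitions_power_two_colors; assumption)

end
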